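(* Let $n\in\{2,4\}$ and let $K,K'\in\mathbb{PL}_n$ be closed oriented PL manifolds of dimension $n$ that are PL homeomorphic. Then $\mathcal{A}_K^{PL}\cong\mathcal{A}_{K'}^{PL}$.
   Context: **Triangulated and PL manifolds.** $n=2h$. $\mathbb{TM}_n$ is the set of closed oriented triangulated manifolds of dimension $n$, i.e. finite abstract simplicial complexes $K$ on a vertex set $[m]=\{1,\dots,m\}$ whose geometric realization is a closed oriented topological $n$-manifold; the $n$-simplices are oriented so that their sum is a cycle, and every lower-dimensional simplex carries the canonical orientation given by increasing order of its vertices. Two triangulated manifolds are PL homeomorphic if they have combinatorially equivalent (simplicially isomorphic) subdivisions. A PL manifold is a triangulated manifold in which the link of every nonempty simplex $\alpha$ is a PL sphere of dimension $n-|\alpha|$ (a triangulated sphere PL homeomorphic to the boundary of a simplex). $\mathbb{PL}_n$ is the set of PL manifolds in $\mathbb{TM}_n$. $\mathcal{F}_i^K$ is the set of $i$-simplices and $\mathcal{F}(K)=\mathcal{F}^K_{n-1}$. Simplices of equal dimension are compared by the lexicographic order $<$ of their increasingly listed vertices. **Bistellar moves.** If $\alpha\in K$ is an $(n-j)$-simplex with $\mathrm{Link}_K\alpha=\partial\beta$, $\beta\notin K$ (so $\dim\beta=j$), then $(\alpha,\beta)$ is a bistellar pair of type $j$ and the bistellar $j$-move at $\alpha$ is $\mathbf{bm}_\alpha K=(K\setminus(\alpha*\partial\beta))\cup(\partial\alpha*\beta)$. For $j=0$, $\beta$ is a new vertex. Now let $j=h$ and $L=\mathbf{bm}_\alpha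 K$. The $n$-simplices common to $K$ and $L$ have the same orientation in both; writing $\alpha=(v_0,\dots,v_h)$, $\beta=(v_{h+1},\dots,v_{n+1})$ with $(v_0,\dots,v_n)$ positively oriented in $K$, the new $n$-simplices are oriented as $(-1)^i(v_0,\dots,\widehat{v_i},\dots,v_{n+1})$, $0\le i\le h$. Let $\Lambda_\alpha=\alpha*\partial\beta$, $\Lambda_\beta=\partial\alpha*\beta$, $\mathcal{D}_\alpha=\mathcal{F}(\Lambda_\alpha)\setminus\mathcal{F}(\Lambda_\beta)$, $\mathcal{D}_\beta=\mathcal{F}(\Lambda_\beta)\setminus\mathcal{F}(\Lambda_\alpha)$ (where $\mathcal F(\cdot)$ denotes the $(n-1)$-simplices), and let $\sigma$ be the involution $v_i\mapsto v_{n+1-i}$ of the vertices of $\alpha\cup\beta$, also used for the inverse move at $\beta$. **Exchange matrix.** For an oriented simplex, $\partial^{(k)}(a_0,\dots,a_n)=\sum_{i_1<\dots<i_k}(-1)^{i_1+\dots+i_k}(\dots,\widehat{a_{i_1}},\dots,\widehat{a_{i_k}},\dots)$, and $\partial^{(k)}(-F)=-\partial^{(k)}F$. For an oriented $n$-simplex $F$ and $(n-1)$-faces $f<g$ of $F$, let $c_{fg}=\pm1$ be the coefficient in $\partial^{(n-1)}F$ of the canonically oriented edge $(f\cup g)\setminus(f\cap g)$; set $b^F_{fg}=c_{fg}$, $b^F_{gf}=-c_{fg}$, and $b^F_{fg}=0$ if $f=g$ or $f,g$ are not both faces of $F$. $B(K)=(b^K_{fg})_{f,g\in\mathcal F(K)}$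 with $b^K_{fg}=\sum_{F\in\mathcal F_n^K}b^F_{fg}$. **Seeds and seed mutation.** Let $(\mathbb P,\oplus,\cdot)$ be a semifield and $\mathbb{ZP}$ the integral group ring of $(\mathbb P,\cdot)$. $\mathcal X(K)=\{x_f\mid f\in\mathcal F(K)\}$ is a set of independent variables and $\mathbb F\mathcal X(K)$ the field of rational functions over $\mathbb{ZP}$ in them. A seed is $\Sigma_K=(\mathcal X(K),\mathbf p_K,B(K))$ with $\mathbf p_K=(p^{\pm}_{K,x})_{x\in\mathcal X(K)}$ in $\mathbb P$, $p^+_{K,x}\oplus p^-_{K,x}=1$. Put $u^K_f=p^+_{K,x_f}/p^-_{K,x_f}$, $[b]_+=\max\{b,0\}$, $\pi^K_{\alpha,f}=\prod_{g\in\mathcal D_\alpha}(p^+_{K,x_g})^{[b^K_{gf}]_+}(p^-_{K,x_g})^{-[-b^K_{gf}]_+}$. For an $h$-move $L=\mathbf{bm}_\alpha K$ the bistellar seed mutation $\Phi_\alpha:\Sigma_K\to\Sigma_L$ replaces $\mathcal X(K)$ by $\mathcal X(L)$, $B(K)$ by $B(L)$, and $\mathbf p_K$ by the normalized tuple $\mathbf p_L$ with $u^L_f=(u^K_{\sigma(f)})^{-1}$ if $f\in\mathcal D_\beta$, $u^L_f=\pi^K_{\alpha,\sigma(f)}u^K_{\sigma(f)}$ if $f\in\mathcal F(\Lambda_\beta)\setminus\mathcal D_\beta$, and $u^L_f=u^K_f$ otherwise; it comes with the exchange relations $x_fx_{\sigma(f)}=M^+_{K,\alpha,f}+M^-_{K,\alpha,f}$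 for $f\in\mathcal D_\alpha$, where $$M^{\pm}_{K,\alpha,f}=\frac{p^{\pm}_{K,x_f}}{D^K_{\alpha,f}}\operatorname{lcm}\Big(\prod_{g}x_g^{[\pm b^K_{fg}]_+},\ \prod_{g}x_{\sigma(g)}^{[\pm b^K_{fg}]_+}\Big),\qquad D^K_{\alpha,f}=\prod_{g:\ b^K_{fg}>0,\ b^K_{f\sigma(g)}<0}x_g^{b^K_{fg}}x_{\sigma(g)}^{b^K_{fg}},$$ all products over $g\in\mathcal F(\Lambda_\alpha)\setminus\mathcal D_\alpha$. **The algebras $\mathcal A_{[L]}$.** For $L\in\mathbb{TM}_n$, $[L]$ is the set of all manifolds obtained from $L$ by finite (possibly empty) sequences of bistellar $h$-moves. Each member carries a seed, and seeds of manifolds related by an $h$-move are related by the corresponding seed mutation. The fields $\mathbb F\mathcal X(L')$, $L'\in[L]$, are identified with one another through the exchange relations (variables common to two clusters are identified, and $x_{\sigma(f)}=(M^++M^-)/x_f$) and regarded as a single field $\mathbb F$ containing $\mathcal X_{[L]}=\bigcup_{L'\in[L]}\mathcal X(L')$, in which all exchange relations hold. $\mathcal A_{[L]}$ is the $\mathbb{ZP}$-subalgebra of $\mathbb F$ generated by $\mathcal X_{[L]}$ (with these exchange relations). **The direct system and $\mathcal A_K^{PL}$.** For $K\in\mathbb{PL}_n$ let $\mathfrak S_K$ be the set of all PL manifolds PL homeomorphic to $K$, and $\widetilde{\mathfrak S}_K$ the set of classes $[L]$, $L\in\mathfrak S_K$. Write $[K_1]\preceq[K_2]$ if $K_2$ is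 obtained from $K_1$ by a finite sequence of bistellar moves $\mathbf{bm}_{\alpha_1},\dots,\mathbf{bm}_{\alpha_l}$ with all $\dim\alpha_i\ge h$ (and $[L]\preceq[L]$ always); for $h=1,2$ this makes $\widetilde{\mathfrak S}_K$ a directed set. The transition maps $e_{[L][L']}:\mathcal A_{[L]}\hookrightarrow\mathcal A_{[L']}$ for $[L]\preceq[L']$ are composites of the embeddings for single moves $L'=\mathbf{bm}_\alpha L$, $\dim\alpha>h$, induced by the following maps on variables $\varphi_\alpha:\mathcal X(L)\to\mathcal X(L')$: if $\dim\alpha=n$, then $\mathcal X(L)\subset\mathcal X(L')$ and $\varphi_\alpha$ is the inclusion; if $n=4$, $\dim\alpha=3$, $\alpha=(a_1,a_2,a_3,a_4)$, $\beta=(b_1,b_2)$, then $\varphi_\alpha(x)=x$ for $x\ne x_\alpha$ and $\varphi_\alpha(x_\alpha)=x_{(a_1,a_2,b_1,b_2)}$. (An $h$-move does not change the class.) $\mathcal A_K^{PL}$ is the limit of this direct system: $\mathcal A_K^{PL}=\lim_{[L]\in\widetilde{\mathfrak S}_K}\mathcal A_{[L]}$. *)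

theory Defs
  imports
    "HOL-Analysis.Analysis"
    "HOL-Algebra.QuotRing"
    "HOL-Algebra.Module"
    "HOL-Library.Multiset"
    "HOL-Library.Poly_Mapping"
    "HOL-Library.List_Lexorder"
    "HOL-Computational_Algebra.Fraction_Field"
begin

section \<open>Simplicial complexes and PL homeomorphism\<close>

text \<open>
  Simplices are finite sets of natural numbers and complexes contain the empty simplex, so that
  joins, links and boundaries need no case distinctions: the boundary of a vertex is
  \<open>{{}}\<close> and the link of a maximal simplex is \<open>{{}}\<close>.
\<close>

definition finite_complex :: "nat set set \<Rightarrow> bool" where
  "finite_complex K \<longleftrightarrow>
     finite K \<and> {} \<in> K \<and> (\<forall>\<sigma>\<in>K. finite \<sigma> \<and> (\<forall>\<tau>. \<tau> \<subseteq> \<sigma> \<longrightarrow> \<tau> \<in> K))"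

definition bdry :: "nat set \<Rightarrow> nat set set" where
  "bdry \<beta> = {\<tau>. \<tau> \<subset> \<beta>}"

definition join :: "nat set set \<Rightarrow> nat set set \<Rightarrow> nat set set" where
  "join A B = {\<sigma> \<union> \<tau> | \<sigma> \<tau>. \<sigma> \<in> A \<and> \<tau> \<in> B}"

definition link :: "nat set set \<Rightarrow> nat set \<Rightarrow> nat set set" where
  "link K \<alpha> = {\<tau> \<in> K. \<tau> \<inter> \<alpha> = {} \<and> \<tau> \<union> \<alpha> \<in> K}"

definition simplices_of_dim :: "nat \<Rightarrow> nat set set \<Rightarrow> nat set set" where
  "simplices_of_dim i K = {\<sigma> \<in> K. card \<sigma> = Suc i}"

text \<open>The simplices of dimension \<open>n - 1\<close>.\<close>

definition facets :: "nat \<Rightarrow> nat set set \<Rightarrow> nat set set" where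
  "facets n K = {\<sigma> \<in> K. card \<sigma> = n}"

text \<open>
  The geometric realization, in barycentric coordinates.  Only finitely many coordinates occur for
  a finite complex, and the topology is that of the product \<open>nat \<Rightarrow> real\<close>.
\<close>

definition realization :: "nat set set \<Rightarrow> (nat \<Rightarrow> real) set" where
  "realization K = {x. (\<forall>v. 0 \<le> x v) \<and> {v. x v \<noteq> 0} \<in> K \<and> (\<Sum>v | x v \<noteq> 0. x v) = 1}"

text \<open>
  \<open>K'\<close> is a subdivision of \<open>K\<close> if its vertices can be placed at points \<open>p v\<close> of \<open>|K|\<close> in such a way
  that every simplex of \<open>K'\<close> lies in a simplex of \<open>K\<close> and the simplexwise affine extension of \<open>p\<close>
  is a bijection (hence, by compactness, a homeomorphism) of \<open>|K'|\<close> onto \<open>|K|\<close>.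
\<close>

definition is_subdivision :: "nat set set \<Rightarrow> nat set set \<Rightarrow> bool" where
  "is_subdivision K' K \<longleftrightarrow> finite_complex K' \<and>
     (\<exists>p :: nat \<Rightarrow> nat \<Rightarrow> real.
        (\<forall>v\<in>\<Union>K'. p v \<in> realization K) \<and>
        (\<forall>\<sigma>\<in>K'. \<exists>\<tau>\<in>K. \<forall>v\<in>\<sigma>. {w. p v w \<noteq> 0} \<subseteq> \<tau>) \<and>
        bij_betw (\<lambda>y w. \<Sum>v\<in>\<Union>K'. y v * p v w) (realization K') (realization K))"

definition complex_iso :: "nat set set \<Rightarrow> nat set set \<Rightarrow> bool" where
  "complex_iso K L \<longleftrightarrow> (\<exists>g. bij_betw g (\<Union>K) (\<Union>L) \<and> (\<lambda>\<sigma>. g ` \<sigma>) ` K = L)"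

definition pl_homeomorphic :: "nat set set \<Rightarrow> nat set set \<Rightarrow> bool" where
  "pl_homeomorphic K L \<longleftrightarrow>
     (\<exists>K' L'. is_subdivision K' K \<and> is_subdivision L' L \<and> complex_iso K' L')"


section \<open>Oriented triangulated manifolds\<close>

text \<open>
  The orientation of an \<open>n\<close>-simplex is recorded as a sign relative to the increasing order of its
  vertices.
\<close>

record oriented_complex =
  simplices :: "nat set set"
  orientation :: "nat set \<Rightarrow> int"

text \<open>
  The coefficient of the canonically oriented face \<open>\<tau>\<close> in \<open>\<partial>\<^sup>(\<^sup>k\<^sup>)(a\<^sub>0,\<dots>,a\<^sub>n)\<close>, where
  \<open>F = {a\<^sub>0 < \<dots> < a\<^sub>n}\<close> and \<open>k = card F - card \<tau>\<close>: the sum in the exponent runs over the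
  positions (counted from 0) of the deleted vertices.
\<close>

definition boundary_coeff :: "nat set \<Rightarrow> nat set \<Rightarrow> int" where
  "boundary_coeff F \<tau> = (-1) ^ (\<Sum>i | i < card F \<and> sorted_list_of_set F ! i \<notin> \<tau>. i)"

text \<open>
  \<open>oriented_sign K [a\<^sub>0,\<dots>,a\<^sub>n]\<close> is \<open>1\<close> if the ordered simplex \<open>(a\<^sub>0,\<dots>,a\<^sub>n)\<close> is positively oriented
  in \<open>K\<close> and \<open>-1\<close> if it is negatively oriented.
\<close>

definition list_sign :: "nat list \<Rightarrow> int" where
  "list_sign as = (-1) ^ card {(i, j). i < j \<and> j < length as \<and> as ! i > as ! j}"

definition oriented_sign :: "oriented_complex \<Rightarrow> nat list \<Rightarrow> int" where
  "oriented_sign K as = orientation K (set as) * list_sign as"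

definition locally_euclidean :: "nat \<Rightarrow> (nat \<Rightarrow> real) set \<Rightarrow> bool" where
  "locally_euclidean n S \<longleftrightarrow>
     (\<forall>x\<in>S. \<exists>U V. openin (top_of_set S) U \<and> x \<in> U \<and> openin (Euclidean_space n) V \<and>
        top_of_set U homeomorphic_space subtopology (Euclidean_space n) V)"

text \<open>
  The set of closed oriented triangulated \<open>n\<close>-manifolds.  Realizations of finite complexes are
  compact, Hausdorff and second countable, so only local Euclideanness has to be required.
\<close>

definition TM :: "nat \<Rightarrow> oriented_complex set" where
  "TM n = {K. finite_complex (simplices K) \<and>
     (\<exists>m\<ge>1. \<Union>(simplices K) = {1..m}) \<and>
     locally_euclidean n (realization (simplices K)) \<and>
     (\<forall>F. if F \<in> simplices_of_dim n (simplices K) then orientation K F \<in> {1, -1}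
          else orientation K F = 0) \<and>
     (\<forall>g\<in>facets n (simplices K).
        (\<Sum>F | F \<in> simplices_of_dim n (simplices K) \<and> g \<subset> F.
           orientation K F * boundary_coeff F g) = 0)}"

text \<open>
  With \<open>|\<alpha>|\<close> the number of vertices of \<open>\<alpha>\<close>, a sphere of dimension \<open>n - |\<alpha>|\<close> is the boundary of a
  simplex with \<open>n + 2 - |\<alpha>|\<close> vertices.
\<close>

definition PL :: "nat \<Rightarrow> oriented_complex set" where
  "PL n = {K \<in> TM n. \<forall>\<alpha>\<in>simplices K. \<alpha> \<noteq> {} \<longrightarrow>
     card \<alpha> \<le> n + 1 \<and> pl_homeomorphic (link (simplices K) \<alpha>) (bdry {0..n + 1 - card \<alpha>})}"


section \<open>Bistellar moves\<close>

definition bistellar_pair :: "nat \<Rightarrow> nat set set \<Rightarrow> nat \<Rightarrow> nat set \<Rightarrow> nat set \<Rightarrow> bool" where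
  "bistellar_pair n K j \<alpha> \<beta> \<longleftrightarrow>
     \<alpha> \<in> K \<and> j \<le> n \<and> card \<alpha> = n - j + 1 \<and> card \<beta> = j + 1 \<and> link K \<alpha> = bdry \<beta> \<and> \<beta> \<notin> K"

definition bm :: "nat set \<Rightarrow> nat set \<Rightarrow> nat set set \<Rightarrow> nat set set" where
  "bm \<alpha> \<beta> K = (K - join (Pow \<alpha>) (bdry \<beta>)) \<union> join (bdry \<alpha>) (Pow \<beta>)"

text \<open>
  The orderings \<open>\<alpha> = (v\<^sub>0,\<dots>,v\<^sub>n\<^sub>-\<^sub>j)\<close>, \<open>\<beta> = (v\<^sub>n\<^sub>-\<^sub>j\<^sub>+\<^sub>1,\<dots>,v\<^sub>n\<^sub>+\<^sub>1)\<close> with \<open>(v\<^sub>0,\<dots>,v\<^sub>n)\<close> positively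
  oriented.
\<close>

definition positive_ordering ::
    "nat \<Rightarrow> oriented_complex \<Rightarrow> nat set \<Rightarrow> nat set \<Rightarrow> nat list \<Rightarrow> bool" where
  "positive_ordering n K \<alpha> \<beta> vs \<longleftrightarrow>
     distinct vs \<and> length vs = n + 2 \<and>
     set (take (card \<alpha>) vs) = \<alpha> \<and> set (drop (card \<alpha>) vs) = \<beta> \<and>
     oriented_sign K (take (n + 1) vs) = 1"

text \<open>
  The sign rule for the new \<open>n\<close>-simplices is the one for \<open>j = h\<close>; for even \<open>n\<close> and
  \<open>\<alpha>\<close> of any dimension it gives the only orientation of \<open>L\<close> extending that of the common
  \<open>n\<close>-simplices, and it does not depend on \<open>vs\<close>.
\<close>

definition bistellar_move ::
    "nat \<Rightarrow> oriented_complex \<Rightarrow> nat set \<Rightarrow> nat set \<Rightarrow> oriented_complex \<Rightarrow> bool" where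
  "bistellar_move n K \<alpha> \<beta> L \<longleftrightarrow>
     K \<in> TM n \<and> L \<in> TM n \<and> (\<exists>j. bistellar_pair n (simplices K) j \<alpha> \<beta>) \<and>
     simplices L = bm \<alpha> \<beta> (simplices K) \<and>
     (\<forall>F \<in> simplices_of_dim n (simplices K) \<inter> simplices_of_dim n (simplices L).
        orientation L F = orientation K F) \<and>
     (\<exists>vs. positive_ordering n K \<alpha> \<beta> vs \<and>
        (\<forall>i<card \<alpha>. oriented_sign L (take i vs @ drop (Suc i) vs) = (-1) ^ i))"

text \<open>Moves of type \<open>h = n / 2\<close>, i.e. \<open>dim \<alpha> = h\<close>.\<close>

definition h_move ::
    "nat \<Rightarrow> oriented_complex \<Rightarrow> nat set \<Rightarrow> nat set \<Rightarrow> oriented_complex \<Rightarrow> bool" where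
  "h_move n K \<alpha> \<beta> L \<longleftrightarrow> bistellar_move n K \<alpha> \<beta> L \<and> card \<alpha> = n div 2 + 1"

definition mutation_class :: "nat \<Rightarrow> oriented_complex \<Rightarrow> oriented_complex set" where
  "mutation_class n L = {L'. (\<lambda>K K'. \<exists>\<alpha> \<beta>. h_move n K \<alpha> \<beta> K')\<^sup>*\<^sup>* L L'}"

definition \<Lambda>_facets :: "nat \<Rightarrow> nat set \<Rightarrow> nat set \<Rightarrow> nat set set" where
  "\<Lambda>_facets n \<alpha> \<beta> = facets n (join (Pow \<alpha>) (bdry \<beta>))"

text \<open>\<open>\<D>\<^sub>\<alpha>\<close> is \<open>D_facets n \<alpha> \<beta>\<close> and \<open>\<D>\<^sub>\<beta>\<close> is \<open>D_facets n \<beta> \<alpha>\<close>.\<close>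

definition D_facets :: "nat \<Rightarrow> nat set \<Rightarrow> nat set \<Rightarrow> nat set set" where
  "D_facets n \<alpha> \<beta> = \<Lambda>_facets n \<alpha> \<beta> - \<Lambda>_facets n \<beta> \<alpha>"

text \<open>The involution \<open>v\<^sub>i \<mapsto> v\<^sub>n\<^sub>+\<^sub>1\<^sub>-\<^sub>i\<close> of the vertices \<open>v\<^sub>0,\<dots>,v\<^sub>n\<^sub>+\<^sub>1\<close>.\<close>

definition reversal :: "nat list \<Rightarrow> nat \<Rightarrow> nat" where
  "reversal vs v = (case map_of (zip vs (rev vs)) v of Some w \<Rightarrow> w | None \<Rightarrow> v)"

text \<open>
  For \<open>h = 2\<close> the involution \<open>\<sigma>\<close> of an \<open>h\<close>-move depends on the chosen positive ordering, so a
  choice of \<open>\<sigma>\<close> for every \<open>h\<close>-move is carried along as a datum \<open>\<sigma> K \<alpha>\<close>.  A move and its inverse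
  share the same involution, which comes from a positive ordering for one of the two.
\<close>

definition involution_choice ::
    "nat \<Rightarrow> oriented_complex set \<Rightarrow> (oriented_complex \<Rightarrow> nat set \<Rightarrow> nat \<Rightarrow> nat) \<Rightarrow> bool" where
  "involution_choice n \<S> \<sigma> \<longleftrightarrow>
     (\<forall>K\<in>\<S>. \<forall>L\<in>\<S>. \<forall>\<alpha> \<beta>. h_move n K \<alpha> \<beta> L \<longrightarrow>
        \<sigma> L \<beta> = \<sigma> K \<alpha> \<and>
        (\<exists>vs. (positive_ordering n K \<alpha> \<beta> vs \<or> positive_ordering n L \<beta> \<alpha> vs) \<and>
              \<sigma> K \<alpha> = reversal vs))"


section \<open>The exchange matrix\<close>

definition face_exchange :: "nat \<Rightarrow> oriented_complex \<Rightarrow> nat set \<Rightarrow> nat set \<Rightarrow> nat set \<Rightarrow> int" where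
  "face_exchange n K F f g =
     (if f \<noteq> g \<and> f \<subseteq> F \<and> g \<subseteq> F \<and> card f = n \<and> card g = n
      then let c = orientation K F * boundary_coeff F ((f \<union> g) - (f \<inter> g))
           in if sorted_list_of_set f < sorted_list_of_set g then c else - c
      else 0)"

definition exchange_matrix :: "nat \<Rightarrow> oriented_complex \<Rightarrow> nat set \<Rightarrow> nat set \<Rightarrow> int" where
  "exchange_matrix n K f g = (\<Sum>F \<in> simplices_of_dim n (simplices K). face_exchange n K F f g)"


section \<open>Semifields and rational functions over the group ring\<close>

class semifield = comm_monoid_mult + inverse +
  fixes oplus :: "'a \<Rightarrow> 'a \<Rightarrow> 'a"
  assumes semifield_left_inverse: "inverse a * a = 1"
    and semifield_divide: "a / b = a * inverse b"
    and oplus_assoc: "oplus (oplus a b) c = oplus a (oplus b c)"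
    and oplus_commute: "oplus a b = oplus b a"
    and oplus_distrib: "a * oplus b c = oplus (a * b) (a * c)"

text \<open>
  The group of a semifield is torsion-free, hence can be linearly ordered.  Such an order plays no
  role for the constructions below; it is chosen only so that the library shows the
  group ring to be an integral domain.
\<close>

definition positive_cone :: "'p::semifield set \<Rightarrow> bool" where
  "positive_cone P \<longleftrightarrow> 1 \<in> P \<and> (\<forall>x\<in>P. \<forall>y\<in>P. x * y \<in> P) \<and> (\<forall>x\<in>P. inverse x \<in> P \<longrightarrow> x = 1)"

lemma semifield_right_inverse: "a * inverse a = (1 :: 'p::semifield)"
  by (metis mult.commute semifield_left_inverse)

lemma semifield_cancel: "a * b = a * c \<Longrightarrow> b = (c :: 'p::semifield)"
  by (metis mult.assoc mult_1 semifield_left_inverse)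

lemma semifield_inverse_unique: "a * b = 1 \<Longrightarrow> b = inverse (a :: 'p::semifield)"
  by (metis semifield_cancel semifield_right_inverse)

fun geom :: "'p::semifield \<Rightarrow> nat \<Rightarrow> 'p" where
  "geom x 0 = 1"
| "geom x (Suc n) = oplus 1 (x * geom x n)"

lemma geom_shift: "oplus 1 (x * geom x n) = oplus (geom x n) (x ^ Suc n)"
proof (induction n)
  case 0
  show ?case by simp
next
  case (Suc n)
  have "oplus 1 (x * geom x (Suc n)) = oplus 1 (x * oplus (geom x n) (x ^ Suc n))"
    using Suc.IH by simp
  also have "\<dots> = oplus (geom x (Suc n)) (x ^ Suc (Suc n))"
    by (simp add: oplus_distrib oplus_assoc)
  finally show ?case .
qed

lemma semifield_torsion_free:
  fixes x :: "'p::semifield"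
  assumes "x ^ Suc n = 1"
  shows "x = 1"
proof (cases n)
  case 0
  with assms show ?thesis by simp
next
  case (Suc m)
  have "x * geom x n = x * oplus 1 (x * geom x m)" using Suc by simp
  also have "\<dots> = x * oplus (geom x m) (x ^ n)" using Suc geom_shift[of x m] by simp
  also have "\<dots> = oplus (x * geom x m) (x ^ Suc n)" by (simp add: oplus_distrib)
  also have "\<dots> = geom x n" using assms Suc by (simp add: oplus_commute)
  finally have "geom x n * x = geom x n * 1" by (simp add: mult.commute)
  then show ?thesis by (rule semifield_cancel)
qed

lemma total_cone_exists:
  "\<exists>P :: 'p::semifield set. positive_cone P \<and> (\<forall>x. x \<in> P \<or> inverse x \<in> P)"
proof -
  have "\<exists>M\<in>{P :: 'p set. positive_cone P}. \<forall>X\<in>{P. positive_cone P}. M \<subseteq> X \<longrightarrow> X = M"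
  proof (rule subset_Zorn_nonempty)
    have "positive_cone {1 :: 'p}" by (auto simp: positive_cone_def)
    then show "{P :: 'p set. positive_cone P} \<noteq> {}" by blast
  next
    fix \<C> :: "'p set set"
    assume ne: "\<C> \<noteq> {}" and ch: "subset.chain {P. positive_cone P} \<C>"
    have sub: "\<And>X. X \<in> \<C> \<Longrightarrow> positive_cone X" and lin: "\<And>X Y. X \<in> \<C> \<Longrightarrow> Y \<in> \<C> \<Longrightarrow> X \<subseteq> Y \<or> Y \<subseteq> X"
      using ch by (auto simp: subset_chain_def)
    have common: "\<exists>Z\<in>\<C>. x \<in> Z \<and> y \<in> Z" if "x \<in> \<Union>\<C>" "y \<in> \<Union>\<C>" for x y
      using that lin by blast
    have "1 \<in> \<Union>\<C>" using ne sub by (auto simp: positive_cone_def)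
    moreover have "x * y \<in> \<Union>\<C>" if "x \<in> \<Union>\<C>" "y \<in> \<Union>\<C>" for x y
      using common[OF that] sub unfolding positive_cone_def by blast
    moreover have "x = 1" if "x \<in> \<Union>\<C>" "inverse x \<in> \<Union>\<C>" for x
      using common[OF that] sub unfolding positive_cone_def by blast
    ultimately show "\<Union>\<C> \<in> {P. positive_cone P}" by (simp add: positive_cone_def)
  qed
  then obtain P :: "'p set" where P: "positive_cone P" and max: "\<And>X. positive_cone X \<Longrightarrow> P \<subseteq> X \<Longrightarrow> X = P"
    by blast
  have P1: "1 \<in> P" and Pm: "\<And>x y. x \<in> P \<Longrightarrow> y \<in> P \<Longrightarrow> x * y \<in> P"
    and Pi: "\<And>x. x \<in> P \<Longrightarrow> inverse x \<in> P \<Longrightarrow> x = 1"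
    using P by (auto simp: positive_cone_def)
  have Ppow: "x ^ k \<in> P" if "x \<in> P" for x k
    by (induction k) (use that P1 Pm in auto)
  have key: "x \<in> P \<or> (\<exists>k. inverse x ^ Suc k \<in> P)" for x
  proof (rule ccontr)
    assume neg: "\<not> (x \<in> P \<or> (\<exists>k. inverse x ^ Suc k \<in> P))"
    define Q where "Q = {p * x ^ k | p k. p \<in> P}"
    have xpow: "x ^ k * inverse x ^ k = 1" for k
      by (metis mult.commute power_mult_distrib power_one semifield_left_inverse)
    have "positive_cone Q"
      unfolding positive_cone_def
    proof (intro conjI ballI impI)
      show "1 \<in> Q" unfolding Q_def using P1 by (auto intro!: exI[of _ 1] exI[of _ 0])
    next
      fix a b assume "a \<in> Q" "b \<in> Q"
      then obtain p k q l where "a = p * x ^ k" "b = q * x ^ l" "p \<in> P" "q \<in> P"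
        by (auto simp: Q_def)
      then have "a * b = (p * q) * x ^ (k + l)" "p * q \<in> P"
        by (auto simp: power_add ac_simps Pm)
      then show "a * b \<in> Q" unfolding Q_def by blast
    next
      fix a assume "a \<in> Q" "inverse a \<in> Q"
      then obtain p k q l where a: "a = p * x ^ k" "inverse a = q * x ^ l" "p \<in> P" "q \<in> P"
        by (auto simp: Q_def)
      have "(p * x ^ k) * (q * x ^ l) = 1"
        using a semifield_right_inverse by metis
      then have "x ^ (k + l) * (p * q) = x ^ (k + l) * inverse x ^ (k + l)"
        by (simp add: xpow power_add ac_simps)
      then have pq: "p * q = inverse x ^ (k + l)" by (rule semifield_cancel)
      have "k + l = 0"
      proof (rule ccontr)
        assume "k + l \<noteq> 0"
        then obtain r where "k + l = Suc r" by (cases "k + l") auto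
        with pq a(3,4) Pm neg show False by metis
      qed
      then have "a = p" "inverse p = q" using a by auto
      then show "a = 1" using a(3,4) Pi by blast
    qed
    moreover have "P \<subseteq> Q"
    proof
      fix p assume "p \<in> P"
      then show "p \<in> Q" unfolding Q_def by (auto intro!: exI[of _ p] exI[of _ 0])
    qed
    ultimately have "Q = P" by (rule max)
    moreover have "x \<in> Q"
      unfolding Q_def using P1 by (auto intro!: exI[of _ 1] exI[of _ 1])
    ultimately show False using neg by blast
  qed
  have "\<forall>x. x \<in> P \<or> inverse x \<in> P"
  proof (rule allI, rule ccontr)
    fix x
    assume neg: "\<not> (x \<in> P \<or> inverse x \<in> P)"
    have ii: "inverse (inverse x) = x"
      by (metis semifield_inverse_unique semifield_left_inverse)
    obtain k where k: "inverse x ^ Suc k \<in> P" using key[of x] neg by blast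
    obtain l where l: "x ^ Suc l \<in> P" using key[of "inverse x"] neg ii by auto
    define y where "y = x ^ (Suc k * Suc l)"
    have "y = (x ^ Suc l) ^ Suc k"
      unfolding y_def by (subst mult.commute) (rule power_mult)
    then have y1: "y \<in> P" using Ppow[OF l] by (simp only:)
    have "y * (inverse x ^ Suc k) ^ Suc l = (x * inverse x) ^ (Suc k * Suc l)"
      unfolding y_def power_mult[symmetric] power_mult_distrib ..
    also have "\<dots> = 1" by (simp only: semifield_right_inverse power_one)
    finally have "inverse y = (inverse x ^ Suc k) ^ Suc l"
      by (rule semifield_inverse_unique[symmetric])
    then have "inverse y \<in> P" using Ppow[OF k] by (simp only:)
    then have "y = 1" using y1 Pi by blast
    moreover have "Suc k * Suc l = Suc (k * Suc l + l)" by simp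
    ultimately have "x ^ Suc (k * Suc l + l) = 1" unfolding y_def by argo
    then have "x = 1" by (rule semifield_torsion_free)
    then show False using neg P1 by blast
  qed
  with P have "positive_cone P \<and> (\<forall>x. x \<in> P \<or> inverse x \<in> P)" ..
  then show ?thesis ..
qed

text \<open>The multiplicative group of \<open>'p\<close>, written additively.\<close>

typedef 'p grp = "UNIV :: 'p set" morphisms of_grp to_grp ..

setup_lifting type_definition_grp

instantiation grp :: (semifield) ab_group_add
begin

lift_definition zero_grp :: "'a grp" is "1" .
lift_definition plus_grp :: "'a grp \<Rightarrow> 'a grp \<Rightarrow> 'a grp" is "(*)" .
lift_definition uminus_grp :: "'a grp \<Rightarrow> 'a grp" is inverse .
lift_definition minus_grp :: "'a grp \<Rightarrow> 'a grp \<Rightarrow> 'a grp" is "\<lambda>a b. a * inverse b" .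

instance
proof
  fix a b c :: "'a grp"
  show "a + b + c = a + (b + c)" by transfer (rule mult.assoc)
  show "a + b = b + a" by transfer (rule mult.commute)
  show "0 + a = a" by transfer (rule mult_1)
  show "- a + a = 0" by transfer (rule semifield_left_inverse)
  show "a - b = a + - b" by transfer (rule refl)
qed

end

definition chosen_cone :: "'p::semifield set" where
  "chosen_cone = (SOME P. positive_cone P \<and> (\<forall>x. x \<in> P \<or> inverse x \<in> P))"

lemma chosen_cone: "positive_cone chosen_cone" "x \<in> chosen_cone \<or> inverse x \<in> chosen_cone"
  using someI_ex[OF total_cone_exists, folded chosen_cone_def] by auto

instantiation grp :: (semifield) ord
begin

definition less_eq_grp :: "'a grp \<Rightarrow> 'a grp \<Rightarrow> bool" where
  "a \<le> b \<longleftrightarrow> of_grp (b - a) \<in> chosen_cone"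

definition less_grp :: "'a grp \<Rightarrow> 'a grp \<Rightarrow> bool" where
  "a < b \<longleftrightarrow> a \<le> b \<and> \<not> b \<le> (a :: 'a grp)"

instance ..

end

instance grp :: (semifield) linordered_ab_group_add
proof
  have plus: "of_grp (a + b) = of_grp a * of_grp b" for a b :: "'a grp"
    by (rule plus_grp.rep_eq)
  have uminus: "of_grp (- a) = inverse (of_grp a)" for a :: "'a grp"
    by (rule uminus_grp.rep_eq)
  have zero: "of_grp (0 :: 'a grp) = 1" by (rule zero_grp.rep_eq)
  have cc: "1 \<in> (chosen_cone :: 'a set)"
      "\<And>x y. x \<in> (chosen_cone :: 'a set) \<Longrightarrow> y \<in> chosen_cone \<Longrightarrow> x * y \<in> chosen_cone"
      "\<And>x. x \<in> (chosen_cone :: 'a set) \<Longrightarrow> inverse x \<in> chosen_cone \<Longrightarrow> x = 1"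
    using chosen_cone(1)[where 'a = 'a] by (auto simp: positive_cone_def)
  have rev: "of_grp (a - b) = inverse (of_grp (b - a))" for a b :: "'a grp"
    using uminus[of "b - a"] by (simp only: minus_diff_eq)
  fix a b c :: "'a grp"
  show "a < b \<longleftrightarrow> a \<le> b \<and> \<not> b \<le> a" by (rule less_grp_def)
  show "a \<le> a" by (simp only: less_eq_grp_def diff_self zero cc(1))
  show "a \<le> c" if "a \<le> b" "b \<le> c"
  proof -
    have "of_grp ((c - b) + (b - a)) \<in> chosen_cone"
      unfolding plus using that by (intro cc(2)) (simp_all only: less_eq_grp_def)
    moreover have "(c - b) + (b - a) = c - a" by simp
    ultimately show ?thesis unfolding less_eq_grp_def by (simp only:)
  qed
  show "a = b" if "a \<le> b" "b \<le> a"
  proof -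
    have "of_grp (b - a) = 1"
      using that unfolding less_eq_grp_def rev[of a b] by (rule cc(3))
    then have "b - a = 0" by (simp only: zero[symmetric] of_grp_inject)
    then show ?thesis by simp
  qed
  show "c + a \<le> c + b" if "a \<le> b"
    using that by (simp only: less_eq_grp_def add_diff_cancel_left)
  show "a \<le> b \<or> b \<le> a"
    unfolding less_eq_grp_def rev[of a b] by (rule chosen_cone(2))
qed

text \<open>
  The group ring \<open>\<int>\<P>\<close>, polynomials over it, and rational functions over it.  Indeterminates are
  indexed by the increasing vertex lists of all simplices; the field \<open>\<bbbF>\<X>(K)\<close> consists of the
  rational functions in those indexed by facets of \<open>K\<close>.
\<close>

type_synonym 'p group_ring = "'p grp \<Rightarrow>\<^sub>0 int"
type_synonym 'p facet_poly = "(nat list \<Rightarrow>\<^sub>0 nat) \<Rightarrow>\<^sub>0 'p group_ring"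
type_synonym 'p ratfun = "'p facet_poly fract"

definition scalar :: "'p::semifield group_ring \<Rightarrow> 'p ratfun" where
  "scalar c = Fract (Poly_Mapping.single 0 c) 1"

definition coef :: "'p::semifield \<Rightarrow> 'p ratfun" where
  "coef q = scalar (Poly_Mapping.single (to_grp q) 1)"

definition var :: "nat set \<Rightarrow> 'p::semifield ratfun" where
  "var f = Fract (Poly_Mapping.single (Poly_Mapping.single (sorted_list_of_set f) 1) 1) 1"


section \<open>Seeds and seed mutation\<close>

text \<open>
  The cluster and the exchange matrix of the seed of \<open>K\<close> are determined by \<open>K\<close>, so a family of
  seeds is given by its coefficients \<open>p K f = (p\<^sup>+, p\<^sup>-)\<close>.
\<close>

type_synonym 'p coefficients = "oriented_complex \<Rightarrow> nat set \<Rightarrow> 'p \<times> 'p"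

definition u_coeff :: "'p::semifield coefficients \<Rightarrow> oriented_complex \<Rightarrow> nat set \<Rightarrow> 'p" where
  "u_coeff p K f = fst (p K f) / snd (p K f)"

text \<open>Here \<open>nat b\<close> is \<open>[b]\<^sub>+\<close>.\<close>

definition pi_coeff ::
    "nat \<Rightarrow> 'p::semifield coefficients \<Rightarrow> oriented_complex \<Rightarrow> nat set \<Rightarrow> nat set \<Rightarrow> nat set \<Rightarrow> 'p" where
  "pi_coeff n p K \<alpha> \<beta> f =
     (\<Prod>g\<in>D_facets n \<alpha> \<beta>.
        fst (p K g) ^ nat (exchange_matrix n K g f) *
        inverse (snd (p K g) ^ nat (- exchange_matrix n K g f)))"

text \<open>Together with normalization, \<open>u_coeff\<close> determines the coefficients.\<close>

definition coefficient_mutation ::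
    "nat \<Rightarrow> (oriented_complex \<Rightarrow> nat set \<Rightarrow> nat \<Rightarrow> nat) \<Rightarrow> 'p::semifield coefficients \<Rightarrow>
     oriented_complex \<Rightarrow> nat set \<Rightarrow> nat set \<Rightarrow> oriented_complex \<Rightarrow> bool" where
  "coefficient_mutation n \<sigma> p K \<alpha> \<beta> L \<longleftrightarrow>
     (\<forall>f\<in>facets n (simplices L).
        u_coeff p L f =
          (if f \<in> D_facets n \<beta> \<alpha> then inverse (u_coeff p K (\<sigma> K \<alpha> ` f))
           else if f \<in> \<Lambda>_facets n \<beta> \<alpha>
             then pi_coeff n p K \<alpha> \<beta> (\<sigma> K \<alpha> ` f) * u_coeff p K (\<sigma> K \<alpha> ` f)
           else u_coeff p K f))"

definition seed_family ::
    "nat \<Rightarrow> oriented_complex set \<Rightarrow> (oriented_complex \<Rightarrow> nat set \<Rightarrow> nat \<Rightarrow> nat) \<Rightarrow>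
     'p::semifield coefficients \<Rightarrow> bool" where
  "seed_family n \<S> \<sigma> p \<longleftrightarrow>
     (\<forall>K\<in>\<S>. \<forall>f\<in>facets n (simplices K). oplus (fst (p K f)) (snd (p K f)) = 1) \<and>
     (\<forall>K\<in>\<S>. \<forall>L\<in>\<S>. \<forall>\<alpha> \<beta>. h_move n K \<alpha> \<beta> L \<longrightarrow> coefficient_mutation n \<sigma> p K \<alpha> \<beta> L)"

text \<open>
  Monomials in the cluster variables of \<open>K\<close> are multisets of facets; their least common multiple is
  the union \<open>\<union>#\<close> (pointwise maximum of multiplicities).  The argument \<open>\<epsilon>\<close> is \<open>1\<close> or \<open>-1\<close>.
\<close>

definition exchange_monomial ::
    "nat \<Rightarrow> oriented_complex \<Rightarrow> nat set \<Rightarrow> nat set \<Rightarrow> nat set \<Rightarrow> int \<Rightarrow> nat set multiset" where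
  "exchange_monomial n K \<alpha> \<beta> f \<epsilon> =
     (\<Sum>g\<in>\<Lambda>_facets n \<alpha> \<beta> - D_facets n \<alpha> \<beta>.
        replicate_mset (nat (\<epsilon> * exchange_matrix n K f g)) g)"

definition exchange_denominator ::
    "nat \<Rightarrow> (nat \<Rightarrow> nat) \<Rightarrow> oriented_complex \<Rightarrow> nat set \<Rightarrow> nat set \<Rightarrow> nat set \<Rightarrow> nat set multiset" where
  "exchange_denominator n s K \<alpha> \<beta> f =
     (\<Sum>g | g \<in> \<Lambda>_facets n \<alpha> \<beta> - D_facets n \<alpha> \<beta> \<and>
            exchange_matrix n K f g > 0 \<and> exchange_matrix n K f (s ` g) < 0.
        replicate_mset (nat (exchange_matrix n K f g)) g +
        replicate_mset (nat (exchange_matrix n K f g)) (s ` g))"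

definition evaluate :: "(nat set \<Rightarrow> 'p::semifield ratfun) \<Rightarrow> nat set multiset \<Rightarrow> 'p ratfun" where
  "evaluate x m = prod_mset (image_mset x m)"

definition exchange_term ::
    "nat \<Rightarrow> (nat \<Rightarrow> nat) \<Rightarrow> oriented_complex \<Rightarrow> nat set \<Rightarrow> nat set \<Rightarrow> nat set \<Rightarrow> int \<Rightarrow>
     'p::semifield \<Rightarrow> (nat set \<Rightarrow> 'p ratfun) \<Rightarrow> 'p ratfun" where
  "exchange_term n s K \<alpha> \<beta> f \<epsilon> q x =
     coef q / evaluate x (exchange_denominator n s K \<alpha> \<beta> f) *
     evaluate x (exchange_monomial n K \<alpha> \<beta> f \<epsilon> \<union>#
                 image_mset (\<lambda>g. s ` g) (exchange_monomial n K \<alpha> \<beta> f \<epsilon>))"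

text \<open>
  The cluster of \<open>bm\<^sub>\<alpha> K\<close> obtained from a cluster \<open>x\<close> of \<open>K\<close> by the exchange relations; variables
  of facets that are not exchanged are kept.
\<close>

definition cluster_mutation ::
    "nat \<Rightarrow> (nat \<Rightarrow> nat) \<Rightarrow> 'p::semifield coefficients \<Rightarrow> oriented_complex \<Rightarrow> nat set \<Rightarrow> nat set \<Rightarrow>
     (nat set \<Rightarrow> 'p ratfun) \<Rightarrow> nat set \<Rightarrow> 'p ratfun" where
  "cluster_mutation n s p K \<alpha> \<beta> x f' =
     (if f' \<in> D_facets n \<beta> \<alpha> then
        let f = s ` f' in
          (exchange_term n s K \<alpha> \<beta> f 1 (fst (p K f)) x +
           exchange_term n s K \<alpha> \<beta> f (-1) (snd (p K f)) x) / x f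
      else x f')"


section \<open>The algebra of a mutation class\<close>

text \<open>
  The common field \<open>\<bbbF>\<close> of a class is modelled by \<open>\<bbbF>\<X>(K\<^sub>0)\<close> for a reference member \<open>K\<^sub>0\<close>:
  \<open>cluster_at n \<sigma> p K\<^sub>0 L x\<close> says that \<open>x f\<close> (\<open>f\<close> a facet of \<open>L\<close>) are the elements of
  \<open>\<bbbF>\<X>(K\<^sub>0)\<close> with which the variables of \<open>L\<close> are identified along some sequence of \<open>h\<close>-moves from
  \<open>K\<^sub>0\<close> to \<open>L\<close>.  Nothing is assumed about independence of the sequence; the cluster variables
  along all sequences are generators of the algebra of the class.
\<close>

inductive cluster_at ::
    "nat \<Rightarrow> (oriented_complex \<Rightarrow> nat set \<Rightarrow> nat \<Rightarrow> nat) \<Rightarrow> 'p::semifield coefficients \<Rightarrow>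
     oriented_complex \<Rightarrow> oriented_complex \<Rightarrow> (nat set \<Rightarrow> 'p ratfun) \<Rightarrow> bool"
  for n \<sigma> p K\<^sub>0 where
  initial: "cluster_at n \<sigma> p K\<^sub>0 K\<^sub>0 var"
| mutate: "cluster_at n \<sigma> p K\<^sub>0 K x \<Longrightarrow> h_move n K \<alpha> \<beta> L \<Longrightarrow>
     cluster_at n \<sigma> p K\<^sub>0 L (cluster_mutation n (\<sigma> K \<alpha>) p K \<alpha> \<beta> x)"

definition reference_member :: "oriented_complex set \<Rightarrow> oriented_complex" where
  "reference_member C = (SOME L. L \<in> C)"

definition cluster_variables ::
    "nat \<Rightarrow> (oriented_complex \<Rightarrow> nat set \<Rightarrow> nat \<Rightarrow> nat) \<Rightarrow> 'p::semifield coefficients \<Rightarrow>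
     oriented_complex set \<Rightarrow> 'p ratfun set" where
  "cluster_variables n \<sigma> p C =
     {x f | x f L. cluster_at n \<sigma> p (reference_member C) L x \<and> f \<in> facets n (simplices L)}"

definition is_subalgebra :: "'p::semifield ratfun set \<Rightarrow> bool" where
  "is_subalgebra S \<longleftrightarrow> range scalar \<subseteq> S \<and> (\<forall>a\<in>S. \<forall>b\<in>S. a + b \<in> S \<and> a * b \<in> S)"

definition class_algebra ::
    "nat \<Rightarrow> (oriented_complex \<Rightarrow> nat set \<Rightarrow> nat \<Rightarrow> nat) \<Rightarrow> 'p::semifield coefficients \<Rightarrow>
     oriented_complex set \<Rightarrow> 'p ratfun set" where
  "class_algebra n \<sigma> p C = is_subalgebra hull cluster_variables n \<sigma> p C"


section \<open>The direct system\<close>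

definition pl_type :: "nat \<Rightarrow> oriented_complex \<Rightarrow> oriented_complex set" where
  "pl_type n K = {L \<in> PL n. pl_homeomorphic (simplices L) (simplices K)}"

definition pl_classes :: "nat \<Rightarrow> oriented_complex \<Rightarrow> oriented_complex set set" where
  "pl_classes n K = mutation_class n ` pl_type n K"

text \<open>
  The map \<open>\<phi>\<^sub>\<alpha>\<close> on indices of variables.  If \<open>dim \<alpha> = 3\<close> and \<open>n = 4\<close> then the variable of
  \<open>\<alpha> = (a\<^sub>1,a\<^sub>2,a\<^sub>3,a\<^sub>4)\<close> (increasing) is sent to that of \<open>(a\<^sub>1,a\<^sub>2,b\<^sub>1,b\<^sub>2)\<close>.
\<close>

definition \<phi>_move :: "nat \<Rightarrow> nat set \<Rightarrow> nat set \<Rightarrow> nat set \<Rightarrow> nat set" where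
  "\<phi>_move n \<alpha> \<beta> f =
     (if card \<alpha> = n + 1 then f
      else if f = \<alpha> then set (take 2 (sorted_list_of_set \<alpha>)) \<union> \<beta>
      else f)"

definition algebra_embedding ::
    "'p::semifield ratfun set \<Rightarrow> 'p ratfun set \<Rightarrow> ('p ratfun \<Rightarrow> 'p ratfun) \<Rightarrow> bool" where
  "algebra_embedding A B e \<longleftrightarrow>
     e ` A \<subseteq> B \<and> inj_on e A \<and>
     (\<forall>a\<in>A. \<forall>b\<in>A. e (a + b) = e a + e b \<and> e (a * b) = e a * e b) \<and>
     (\<forall>c. e (scalar c) = scalar c)"

definition move_embedding ::
    "nat \<Rightarrow> (oriented_complex \<Rightarrow> nat set \<Rightarrow> nat \<Rightarrow> nat) \<Rightarrow> 'p::semifield coefficients \<Rightarrow>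
     oriented_complex set \<Rightarrow> oriented_complex set \<Rightarrow> ('p ratfun \<Rightarrow> 'p ratfun) \<Rightarrow> bool" where
  "move_embedding n \<sigma> p C C' e \<longleftrightarrow>
     algebra_embedding (class_algebra n \<sigma> p C) (class_algebra n \<sigma> p C') e \<and>
     (\<exists>L\<in>C. \<exists>L'\<in>C'. \<exists>\<alpha> \<beta> x x'.
        bistellar_move n L \<alpha> \<beta> L' \<and> card \<alpha> > n div 2 + 1 \<and>
        cluster_at n \<sigma> p (reference_member C) L x \<and>
        cluster_at n \<sigma> p (reference_member C') L' x' \<and>
        (\<forall>f\<in>facets n (simplices L). e (x f) = x' (\<phi>_move n \<alpha> \<beta> f)))"

text \<open>
  A system may a priori contain no or several transition maps between two given classes.
  The transition maps \<open>e\<close> from \<open>C\<close> to \<open>C'\<close> are the composites of embeddings for single moves; as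
  \<open>h\<close>-moves do not leave a class, they exist only for \<open>C \<preceq> C'\<close>.
\<close>

inductive transition_map ::
    "nat \<Rightarrow> (oriented_complex \<Rightarrow> nat set \<Rightarrow> nat \<Rightarrow> nat) \<Rightarrow> 'p::semifield coefficients \<Rightarrow>
     oriented_complex set set \<Rightarrow> oriented_complex set \<Rightarrow> oriented_complex set \<Rightarrow>
     ('p ratfun \<Rightarrow> 'p ratfun) \<Rightarrow> bool"
  for n \<sigma> p I where
  identity: "C \<in> I \<Longrightarrow> transition_map n \<sigma> p I C C id"
| compose: "transition_map n \<sigma> p I C C' e \<Longrightarrow> C'' \<in> I \<Longrightarrow> move_embedding n \<sigma> p C' C'' e' \<Longrightarrow>
     transition_map n \<sigma> p I C C'' (e' \<circ> e)"


section \<open>Limits of systems of algebras\<close>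

text \<open>
  The limit of a system of \<open>\<int>\<P>\<close>-algebras \<open>A i\<close>, \<open>i \<in> I\<close>, with transition maps \<open>T i j e\<close> is
  its colimit in the category of commutative \<open>\<int>\<P>\<close>-algebras: the polynomial algebra on the disjoint
  union of the \<open>A i\<close>, modulo the relations that make every \<open>A i\<close> map into it by an algebra
  homomorphism and that identify \<open>a\<close> with \<open>e a\<close> for every transition map \<open>e\<close>.  For a directed system
  this is the usual direct limit.
\<close>

type_synonym ('i, 'p) gen_poly = "('i \<times> 'p ratfun \<Rightarrow>\<^sub>0 nat) \<Rightarrow>\<^sub>0 'p group_ring"

definition gen :: "'i \<Rightarrow> 'p::semifield ratfun \<Rightarrow> ('i, 'p) gen_poly" where
  "gen i a = Poly_Mapping.single (Poly_Mapping.single (i, a) 1) 1"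

definition gen_ring :: "('i \<times> 'p::semifield ratfun) set \<Rightarrow> ('i, 'p) gen_poly ring" where
  "gen_ring V =
     \<lparr>carrier = {P. \<forall>m\<in>Poly_Mapping.keys P. Poly_Mapping.keys m \<subseteq> V},
      mult = (*), one = 1, zero = 0, add = (+)\<rparr>"

definition limit_relations ::
    "'i set \<Rightarrow> ('i \<Rightarrow> 'p::semifield ratfun set) \<Rightarrow> ('i \<Rightarrow> 'i \<Rightarrow> ('p ratfun \<Rightarrow> 'p ratfun) \<Rightarrow> bool) \<Rightarrow>
     ('i, 'p) gen_poly set" where
  "limit_relations I A T =
     {gen i a + gen i b - gen i (a + b) | i a b. i \<in> I \<and> a \<in> A i \<and> b \<in> A i} \<union>
     {gen i a * gen i b - gen i (a * b) | i a b. i \<in> I \<and> a \<in> A i \<and> b \<in> A i} \<union>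
     {gen i (scalar c) - Poly_Mapping.single 0 c | i c. i \<in> I} \<union>
     {gen i a - gen j (e a) | i j e a. i \<in> I \<and> j \<in> I \<and> T i j e \<and> a \<in> A i}"

definition limit_algebra ::
    "'i set \<Rightarrow> ('i \<Rightarrow> 'p::semifield ratfun set) \<Rightarrow> ('i \<Rightarrow> 'i \<Rightarrow> ('p ratfun \<Rightarrow> 'p ratfun) \<Rightarrow> bool) \<Rightarrow>
     ('p group_ring, ('i, 'p) gen_poly set) module" where
  "limit_algebra I A T =
     (let R = gen_ring (Sigma I A);
          J = genideal R (limit_relations I A T);
          Q = R Quot J
      in ring.extend Q
           (module.fields (\<lambda>c X. (J +>\<^bsub>R\<^esub> Poly_Mapping.single 0 c) \<otimes>\<^bsub>Q\<^esub> X)))"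

definition A_PL ::
    "nat \<Rightarrow> (oriented_complex \<Rightarrow> nat set \<Rightarrow> nat \<Rightarrow> nat) \<Rightarrow> 'p::semifield coefficients \<Rightarrow>
     oriented_complex \<Rightarrow>
     ('p group_ring, (oriented_complex set, 'p) gen_poly set) module" where
  "A_PL n \<sigma> p K =
     limit_algebra (pl_classes n K) (class_algebra n \<sigma> p)
       (transition_map n \<sigma> p (pl_classes n K))"

definition algebra_isomorphic :: "('c, 'a) module \<Rightarrow> ('c, 'b) module \<Rightarrow> bool" where
  "algebra_isomorphic A B \<longleftrightarrow>
     (\<exists>\<psi>\<in>ring_iso A B. \<forall>c. \<forall>a\<in>carrier A. \<psi> (c \<odot>\<^bsub>A\<^esub> a) = c \<odot>\<^bsub>B\<^esub> \<psi> a)"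

end

theory Submission
  imports Defs "HOL-Computational_Algebra.Polynomial"
begin

text \<open>
  The system defining \<open>A_PL n \<sigma> p K\<close> depends on \<open>K\<close> only through the set \<open>pl_type n K\<close>, so the two
  algebras are equal as soon as PL homeomorphism is transitive.  For this one needs a common
  subdivision of two subdivisions of a complex of dimension at most 4.  Such a complex embeds in
  nine-dimensional space with its vertices on the moment curve; the intersections of the simplices
  of the two subdivisions then form a complex of convex polytopes, and a simplicial subdivision of
  it is a common subdivision.
\<close>

section \<open>Simplexwise affine maps\<close>

text \<open>Two PL homeomorphisms that meet in \<open>K\<close> use unrelated subdivisions of
  \<open>K\<close>, and they compose only through a common subdivision of these. Superposing
  subdivisions is a question about convex polytopes, and polytopes live in types of class
  \<open>euclidean_space\<close>, whose dimension is fixed, whereas a point of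
  \<open>realization K\<close> has as many barycentric coordinates as \<open>K\<close> has vertices.
  The embedding removes this obstacle because its dimension depends only on that of
  \<open>K\<close>: two simplices with at most five vertices each have at most ten vertices
  together, and any ten points of the moment curve in nine-dimensional space are affinely
  independent. Only \<open>K\<close> is placed on the curve; its subdivisions inherit their
  embeddings from the positions of their vertices in \<open>realization K\<close>. Isomorphisms need
  no separate treatment, since isomorphic finite complexes subdivide each other, so everything
  happens inside the transitive relation \<open>is_subdivision\<close>.\<close>

definition supp :: "(nat \<Rightarrow> real) \<Rightarrow> nat set" where
  "supp y = {v. y v \<noteq> 0}"

text \<open>For \<open>\<sigma> = {}\<close> this is the empty set, because an empty sum is not 1;
  the empty simplex of a complex therefore contributes no points.\<close>

definition closed_simplex :: "nat set \<Rightarrow> (nat \<Rightarrow> real) set" where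
  "closed_simplex \<sigma> = {y. (\<forall>v. 0 \<le> y v) \<and> supp y \<subseteq> \<sigma> \<and> (\<Sum>v\<in>\<sigma>. y v) = 1}"

text \<open>Summing over the support keeps the vertex set of a complex out of the map, so that maps
  on different complexes can be composed and compared.\<close>

definition affine_ext :: "(nat \<Rightarrow> 'a::real_vector) \<Rightarrow> (nat \<Rightarrow> real) \<Rightarrow> 'a" where
  "affine_ext q y = (\<Sum>v\<in>supp y. y v *\<^sub>R q v)"

text \<open>The counterpart of \<open>affine_ext\<close> when vertices are placed at points of
  another realization, written coordinate by coordinate.\<close>

definition coord_ext :: "(nat \<Rightarrow> nat \<Rightarrow> real) \<Rightarrow> (nat \<Rightarrow> real) \<Rightarrow> nat \<Rightarrow> real" where
  "coord_ext p y w = (\<Sum>v\<in>supp y. y v * p v w)"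

lemma affine_ext_superset:
  "finite S \<Longrightarrow> supp y \<subseteq> S \<Longrightarrow> affine_ext q y = (\<Sum>v\<in>S. y v *\<^sub>R q v)"
  unfolding affine_ext_def by (rule sum.mono_neutral_left) (auto simp: supp_def)

lemma coord_ext_superset:
  "finite S \<Longrightarrow> supp y \<subseteq> S \<Longrightarrow> coord_ext p y w = (\<Sum>v\<in>S. y v * p v w)"
  unfolding coord_ext_def by (rule sum.mono_neutral_left) (auto simp: supp_def)

lemma closed_simplex_mono:
  assumes "\<sigma> \<subseteq> \<tau>" "finite \<tau>"
  shows "closed_simplex \<sigma> \<subseteq> closed_simplex \<tau>"
proof
  fix y assume y: "y \<in> closed_simplex \<sigma>"
  then have "(\<Sum>v\<in>\<tau>. y v) = (\<Sum>v\<in>\<sigma>. y v)"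
    using assms by (intro sum.mono_neutral_right) (auto simp: closed_simplex_def supp_def)
  with y assms show "y \<in> closed_simplex \<tau>"
    by (auto simp: closed_simplex_def)
qed

lemma closed_simplex_supp:
  assumes "y \<in> closed_simplex \<sigma>" "supp y \<subseteq> \<tau>" "finite \<sigma>" "finite \<tau>"
  shows "y \<in> closed_simplex \<tau>"
proof -
  have "(\<Sum>v\<in>\<rho>. y v) = (\<Sum>v\<in>supp y. y v)" if "supp y \<subseteq> \<rho>" "finite \<rho>" for \<rho>
    using that by (intro sum.mono_neutral_right) (auto simp: supp_def)
  with assms show ?thesis by (auto simp: closed_simplex_def)
qed

lemma finite_complexD:
  assumes "finite_complex K"
  shows "finite (\<Union>K)" "{} \<in> K" "\<And>\<sigma>. \<sigma> \<in> K \<Longrightarrow> finite \<sigma>"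
    "\<And>\<sigma> \<tau>. \<sigma> \<in> K \<Longrightarrow> \<tau> \<subseteq> \<sigma> \<Longrightarrow> \<tau> \<in> K"
  using assms by (auto simp: finite_complex_def)

lemma realization_eq:
  assumes "finite_complex K"
  shows "realization K = (\<Union>\<sigma>\<in>K. closed_simplex \<sigma>)"
proof (intro equalityI subsetI)
  fix y assume "y \<in> realization K"
  then show "y \<in> (\<Union>\<sigma>\<in>K. closed_simplex \<sigma>)"
    by (auto simp: realization_def closed_simplex_def supp_def)
next
  fix y assume "y \<in> (\<Union>\<sigma>\<in>K. closed_simplex \<sigma>)"
  then obtain \<sigma> where \<sigma>: "\<sigma> \<in> K" "y \<in> closed_simplex \<sigma>" by auto
  have sub: "supp y \<subseteq> \<sigma>" using \<sigma> by (auto simp: closed_simplex_def)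
  then have K: "supp y \<in> K" using finite_complexD[OF assms] \<sigma> by blast
  then have "y \<in> closed_simplex (supp y)"
    using closed_simplex_supp[OF \<sigma>(2)] finite_complexD[OF assms] \<sigma> by blast
  with K show "y \<in> realization K"
    by (auto simp: realization_def closed_simplex_def supp_def)
qed

lemma supp_realization:
  assumes "finite_complex K" "y \<in> realization K"
  shows "supp y \<in> K" "supp y \<subseteq> \<Union>K" "supp y \<noteq> {}" "y \<in> closed_simplex (supp y)"
proof -
  have y: "\<forall>v. 0 \<le> y v" "supp y \<in> K" "sum y (supp y) = 1"
    using assms(2) by (auto simp: realization_def supp_def)
  then show "supp y \<in> K" "supp y \<subseteq> \<Union>K" "y \<in> closed_simplex (supp y)"
    by (auto simp: closed_simplex_def)
  show "supp y \<noteq> {}" using y(3) by auto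
qed

lemma closed_simplex_unit: "finite \<sigma> \<Longrightarrow> v \<in> \<sigma> \<Longrightarrow> (\<lambda>w. if w = v then 1 else 0) \<in> closed_simplex \<sigma>"
  by (auto simp: closed_simplex_def supp_def)

lemma affine_ext_unit: "affine_ext q (\<lambda>w. if w = v then 1 else 0) = q v"
  by (simp add: affine_ext_def supp_def)

text \<open>Weights in \<open>convex_hull_finite\<close> are indexed by points, barycentric
  coordinates by vertices; injectivity of \<open>q\<close> translates one into the other.\<close>

lemma convex_hull_eq_affine_ext:
  assumes "finite \<sigma>" "inj_on q \<sigma>"
  shows "convex hull (q ` \<sigma>) = affine_ext q ` closed_simplex \<sigma>"
proof (intro equalityI subsetI)
  fix z assume "z \<in> convex hull (q ` \<sigma>)"
  then obtain u where u: "\<forall>x\<in>q ` \<sigma>. 0 \<le> u x" "sum u (q ` \<sigma>) = 1"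
      "(\<Sum>x\<in>q ` \<sigma>. u x *\<^sub>R x) = z"
    using assms by (auto simp: convex_hull_finite)
  define y where "y = (\<lambda>v. if v \<in> \<sigma> then u (q v) else 0)"
  have s: "supp y \<subseteq> \<sigma>" by (auto simp: supp_def y_def)
  have "y \<in> closed_simplex \<sigma>"
    using u s by (auto simp: closed_simplex_def y_def sum.reindex[OF assms(2)])
  moreover have "affine_ext q y = z"
    using u(3) affine_ext_superset[OF assms(1) s, of q]
    by (auto simp: sum.reindex[OF assms(2)] y_def)
  ultimately show "z \<in> affine_ext q ` closed_simplex \<sigma>" by blast
next
  fix z assume "z \<in> affine_ext q ` closed_simplex \<sigma>"
  then obtain y where y: "y \<in> closed_simplex \<sigma>" "z = affine_ext q y" by auto
  then have "z = (\<Sum>v\<in>\<sigma>. y v *\<^sub>R q v)"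
    using affine_ext_superset[OF assms(1)] by (auto simp: closed_simplex_def)
  also have "\<dots> \<in> convex hull (q ` \<sigma>)"
    using y assms by (intro convex_sum) (auto simp: closed_simplex_def intro: hull_inc)
  finally show "z \<in> convex hull (q ` \<sigma>)" .
qed

section \<open>Geometric simplicial complexes\<close>

text \<open>Global injectivity packs two geometric conditions into one: the vertices of every
  simplex are affinely independent, and two simplices meet in their common face. Both are derived
  below.\<close>

locale geometric_complex =
  fixes K :: "nat set set" and q :: "nat \<Rightarrow> 'a::euclidean_space"
  assumes complex: "finite_complex K" and inj: "inj_on (affine_ext q) (realization K)"
begin

lemma simplex_subset: "\<sigma> \<in> K \<Longrightarrow> closed_simplex \<sigma> \<subseteq> realization K"
  using realization_eq[OF complex] by auto

lemma inj_vertices: "inj_on q (\<Union>K)"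
proof (rule inj_onI)
  fix v w assume vw: "v \<in> \<Union>K" "w \<in> \<Union>K" "q v = q w"
  have "(\<lambda>u. if u = x then 1 else 0) \<in> realization K" if x: "x \<in> \<Union>K" for x
  proof -
    obtain \<sigma> where "\<sigma> \<in> K" "x \<in> \<sigma>" using x by blast
    then show ?thesis
      using subsetD[OF simplex_subset closed_simplex_unit] finite_complexD(3)[OF complex] by simp
  qed
  with vw inj_onD[OF inj, of "\<lambda>u. if u = v then 1 else 0" "\<lambda>u. if u = w then 1 else 0"]
  have "(\<lambda>u. if u = v then 1 else (0::real)) = (\<lambda>u. if u = w then 1 else 0)"
    by (simp add: affine_ext_unit)
  from fun_cong[OF this, of v] show "v = w" by (auto split: if_splits)
qed

lemma hull_eq: "\<sigma> \<in> K \<Longrightarrow> convex hull (q ` \<sigma>) = affine_ext q ` closed_simplex \<sigma>"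
  using finite_complexD(3)[OF complex] inj_on_subset[OF inj_vertices Union_upper]
  by (intro convex_hull_eq_affine_ext)

text \<open>As in the proof of Radon's theorem, an affine dependence splits into its positive and
  negative parts; after scaling these are two different points of the simplex with the same
  image.\<close>

lemma affine_independent:
  assumes "\<sigma> \<in> K"
  shows "\<not> affine_dependent (q ` \<sigma>)"
proof
  have fin: "finite \<sigma>" using assms finite_complexD[OF complex] by blast
  have injq: "inj_on q \<sigma>" using assms inj_on_subset[OF inj_vertices] by blast
  assume "affine_dependent (q ` \<sigma>)"
  then obtain U where U: "sum U (q ` \<sigma>) = 0" "\<exists>x\<in>q ` \<sigma>. U x \<noteq> 0" "(\<Sum>x\<in>q ` \<sigma>. U x *\<^sub>R x) = 0"
    using fin by (auto simp: affine_dependent_explicit_finite)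
  define c where "c v = U (q v)" for v
  have c0: "(\<Sum>v\<in>\<sigma>. c v) = 0" and c1: "(\<Sum>v\<in>\<sigma>. c v *\<^sub>R q v) = 0"
    using U by (auto simp: sum.reindex[OF injq] c_def)
  obtain v0 where v0: "v0 \<in> \<sigma>" "c v0 \<noteq> 0" using U by (auto simp: c_def)
  \<comment> \<open>The coefficients sum to 0, so the positive and the negative parts have the same
    total \<open>s\<close>, and division by it makes both of them barycentric coordinates.\<close>
  define s where "s = (\<Sum>v\<in>\<sigma>. max 0 (c v))"
  have split: "max 0 (c v) = c v + max 0 (- c v)" for v by auto
  have s': "s = (\<Sum>v\<in>\<sigma>. max 0 (- c v))"
    unfolding s_def by (subst split) (simp add: sum.distrib c0)
  have spos: "s > 0"
  proof (cases "c v0 > 0")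
    case True
    then show ?thesis unfolding s_def using v0 fin by (intro sum_pos2[of _ v0]) auto
  next
    case False
    then show ?thesis unfolding s' using v0 fin by (intro sum_pos2[of _ v0]) auto
  qed
  define y where "y = (\<lambda>v. if v \<in> \<sigma> then max 0 (c v) / s else 0)"
  define y' where "y' = (\<lambda>v. if v \<in> \<sigma> then max 0 (- c v) / s else 0)"
  have sy: "supp y \<subseteq> \<sigma>" "supp y' \<subseteq> \<sigma>" by (auto simp: supp_def y_def y'_def)
  have "y \<in> closed_simplex \<sigma>"
    using spos sy by (auto simp: closed_simplex_def y_def sum_divide_distrib[symmetric] s_def[symmetric])
  moreover have "y' \<in> closed_simplex \<sigma>"
    using spos sy by (auto simp: closed_simplex_def y'_def sum_divide_distrib[symmetric] s'[symmetric])
  moreover have "affine_ext q y = affine_ext q y'"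
  proof -
    have "affine_ext q y = (\<Sum>v\<in>\<sigma>. (max 0 (c v) / s) *\<^sub>R q v)"
      using affine_ext_superset[OF fin sy(1), of q] by (simp add: y_def)
    also have "\<dots> = (\<Sum>v\<in>\<sigma>. (1 / s) *\<^sub>R (c v *\<^sub>R q v) + (max 0 (- c v) / s) *\<^sub>R q v)"
      by (intro sum.cong refl) (subst split, simp add: add_divide_distrib scaleR_add_left)
    also have "\<dots> = (\<Sum>v\<in>\<sigma>. (max 0 (- c v) / s) *\<^sub>R q v)"
      by (simp only: sum.distrib scaleR_right.sum[symmetric] c1) simp
    also have "\<dots> = affine_ext q y'"
      using affine_ext_superset[OF fin sy(2), of q] by (simp add: y'_def)
    finally show ?thesis .
  qed
  ultimately have "y = y'"
    using inj_onD[OF inj] simplex_subset[OF assms] by blast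
  \<comment> \<open>As \<open>c v0\<close> is nonzero, exactly one of \<open>y v0\<close> and
    \<open>y' v0\<close> vanishes.\<close>
  from fun_cong[OF this, of v0] v0 spos show False
    by (auto simp: y_def y'_def max_def split: if_splits)
qed

text \<open>A point of both hulls has barycentric coordinates over either simplex. Injectivity makes
  them equal, so their support lies in the intersection.\<close>

lemma hull_Int:
  assumes "\<sigma> \<in> K" "\<tau> \<in> K"
  shows "convex hull (q ` \<sigma>) \<inter> convex hull (q ` \<tau>) = convex hull (q ` (\<sigma> \<inter> \<tau>))"
proof (intro equalityI subsetI)
  fix z assume "z \<in> convex hull (q ` \<sigma>) \<inter> convex hull (q ` \<tau>)"
  then obtain y y' where y: "y \<in> closed_simplex \<sigma>" "y' \<in> closed_simplex \<tau>"
      "z = affine_ext q y" "z = affine_ext q y'"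
    using hull_eq assms by auto
  then have "y = y'"
    using inj_onD[OF inj] simplex_subset assms by (metis subsetD)
  with y have "y \<in> closed_simplex (\<sigma> \<inter> \<tau>)"
    using closed_simplex_supp[OF y(1), of "\<sigma> \<inter> \<tau>"] finite_complexD[OF complex] assms
    by (auto simp: closed_simplex_def)
  moreover have "\<sigma> \<inter> \<tau> \<in> K" using finite_complexD(4)[OF complex assms(1)] by auto
  ultimately show "z \<in> convex hull (q ` (\<sigma> \<inter> \<tau>))" using hull_eq y by auto
next
  show "z \<in> convex hull (q ` \<sigma>) \<inter> convex hull (q ` \<tau>)" if "z \<in> convex hull (q ` (\<sigma> \<inter> \<tau>))" for z
    by (intro IntI subsetD[OF hull_mono that]) auto
qed

lemma hull_Int_face:
  assumes "\<sigma> \<in> K" "\<tau> \<in> K"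
  shows "convex hull (q ` \<sigma>) \<inter> convex hull (q ` \<tau>) face_of convex hull (q ` \<sigma>)"
  unfolding hull_Int[OF assms] face_of_convex_hull_affine_independent[OF affine_independent[OF assms(1)]]
  by (rule exI[of _ "q ` (\<sigma> \<inter> \<tau>)"]) auto

definition cells :: "'a set set" where
  "cells = (\<lambda>\<sigma>. convex hull (q ` \<sigma>)) ` K"

lemma finite_cells: "finite cells"
  using complex by (auto simp: cells_def finite_complex_def)

lemma polytope_cells: "C \<in> cells \<Longrightarrow> polytope C"
  using finite_complexD(3)[OF complex] unfolding cells_def polytope_def by blast

lemma Union_cells: "\<Union>cells = affine_ext q ` realization K"
  by (auto simp: cells_def hull_eq realization_eq[OF complex])

lemma face_cells: "C \<in> cells \<Longrightarrow> D \<in> cells \<Longrightarrow> C \<inter> D face_of C"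
  using hull_Int_face by (auto simp: cells_def)

end

section \<open>Superposing two complexes with the same underlying set\<close>

text \<open>A face of \<open>C1\<close> cut with a face of \<open>C2\<close> is a face of
  \<open>C1 \<inter> C2\<close>, so the pairwise intersections of cells inherit the face condition
  from the two complexes. They cover \<open>X\<close> because each complex does.\<close>

lemma common_refinement:
  fixes q1 q2 :: "nat \<Rightarrow> 'a::euclidean_space"
  assumes "geometric_complex K1 q1" "geometric_complex K2 q2"
    and X: "affine_ext q1 ` realization K1 = X" "affine_ext q2 ` realization K2 = X"
  obtains T where "simplicial_complex T" "\<Union>T = X"
    "\<And>S. S \<in> T \<Longrightarrow> \<exists>\<tau>\<in>K1. S \<subseteq> convex hull (q1 ` \<tau>)"
    "\<And>S. S \<in> T \<Longrightarrow> \<exists>\<tau>\<in>K2. S \<subseteq> convex hull (q2 ` \<tau>)"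
proof -
  interpret K1: geometric_complex K1 q1 by fact
  interpret K2: geometric_complex K2 q2 by fact
  define M where "M = (\<lambda>(C, D). C \<inter> D) ` (K1.cells \<times> K2.cells)"
  have "finite M" using K1.finite_cells K2.finite_cells by (auto simp: M_def)
  moreover have "polytope C" if "C \<in> M" for C
    using that K1.polytope_cells K2.polytope_cells by (auto simp: M_def polytope_Int)
  moreover have "C \<inter> D face_of C" if CD: "C \<in> M" "D \<in> M" for C D
  proof -
    obtain C1 C2 D1 D2 where *: "C1 \<in> K1.cells" "D1 \<in> K1.cells" "C2 \<in> K2.cells" "D2 \<in> K2.cells"
        "C = C1 \<inter> C2" "D = D1 \<inter> D2"
      using CD by (auto simp: M_def)
    have "(C1 \<inter> D1) \<inter> (C2 \<inter> D2) face_of C1 \<inter> C2"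
      using * by (intro face_of_Int_Int K1.face_cells K2.face_cells)
    moreover have "C \<inter> D = (C1 \<inter> D1) \<inter> (C2 \<inter> D2)" using * by auto
    ultimately show ?thesis using * by simp
  qed
  ultimately obtain T where T: "simplicial_complex T" "\<Union>T = \<Union>M"
      "\<And>S. S \<in> T \<Longrightarrow> \<exists>C. C \<in> M \<and> S \<subseteq> C"
    using simplicial_subdivision_of_cell_complex[of M] by metis
  have "\<Union>M = X"
  proof -
    have "\<Union>M = \<Union>K1.cells \<inter> \<Union>K2.cells" by (auto simp: M_def)
    then show ?thesis using K1.Union_cells K2.Union_cells X by simp
  qed
  moreover have "\<exists>\<tau>\<in>K1. S \<subseteq> convex hull (q1 ` \<tau>)" "\<exists>\<tau>\<in>K2. S \<subseteq> convex hull (q2 ` \<tau>)"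
    if "S \<in> T" for S
    using T(3)[OF that] by (auto simp: M_def K1.cells_def K2.cells_def)
  ultimately show ?thesis using T(1,2) by (intro that[of T]) auto
qed

section \<open>Abstract complexes from simplicial complexes in Euclidean space\<close>

lemma extreme_points_convex_hull:
  fixes C :: "'a::euclidean_space set"
  shows "\<not> affine_dependent C \<Longrightarrow> {x. x extreme_point_of (convex hull C)} = C"
  by (auto simp: extreme_point_of_convex_hull_affine_independent)

lemma simplicial_complex_abstract:
  fixes T :: "'a::euclidean_space set set"
  assumes "simplicial_complex T"
  obtains N and r :: "nat \<Rightarrow> 'a" where "finite_complex N"
    "bij_betw (affine_ext r) (realization N) (\<Union>T)"
    "\<And>\<sigma>. \<sigma> \<in> N \<Longrightarrow> \<sigma> \<noteq> {} \<Longrightarrow> convex hull (r ` \<sigma>) \<in> T"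
proof -
  \<comment> \<open>The vertex sets of members of \<open>T\<close>. The empty set is adjoined by
    hand: \<open>finite_complex\<close> demands it, but \<open>T\<close> may be empty.\<close>
  define G where "G = {C. \<not> affine_dependent C \<and> (C = {} \<or> convex hull C \<in> T)}"
  \<comment> \<open>A simplex determines its vertices as its extreme points, so \<open>G\<close> is
    finite because \<open>T\<close> is.\<close>
  have "G \<subseteq> insert {} ((\<lambda>S. {x. x extreme_point_of S}) ` T)"
  proof
    fix C assume C: "C \<in> G"
    show "C \<in> insert {} ((\<lambda>S. {x. x extreme_point_of S}) ` T)"
    proof (cases "C = {}")
      case False
      then show ?thesis
        using C extreme_points_convex_hull[of C] by (intro insertI2 image_eqI[of _ _ "convex hull C"]) (auto simp: G_def)
    qed simp
  qed
  moreover have "finite T" using assms by (simp add: simplicial_complex_def)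
  ultimately have "finite G" by (simp add: finite_subset)
  moreover have finG: "finite C" if "C \<in> G" for C
    using that aff_independent_finite by (auto simp: G_def)
  ultimately have "finite (\<Union>G)" by auto
  \<comment> \<open>Abstract simplices are sets of natural numbers, hence the geometric vertices are
    numbered.\<close>
  then obtain m r where "bij_betw r {..<m::nat} (\<Union>G)"
    using ex_bij_betw_nat_finite atLeast0LessThan by metis
  then have r: "inj_on r {..<m}" "r ` {..<m} = \<Union>G" by (auto simp: bij_betw_def)
  have Gsub: "D \<in> G" if "C \<in> G" "D \<subseteq> C" for C D
  proof (cases "D = {}")
    case False
    then have C: "\<not> affine_dependent C" "convex hull C \<in> T" using that by (auto simp: G_def)
    have "convex hull D face_of convex hull C"
      using face_of_convex_hull_affine_independent[OF C(1)] that by blast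
    then have "convex hull D \<in> T" using assms C by (auto simp: simplicial_complex_def)
    then show ?thesis using C that affine_dependent_subset by (auto simp: G_def)
  qed (simp add: G_def)
  define N where "N = {\<sigma>. \<sigma> \<subseteq> {..<m} \<and> r ` \<sigma> \<in> G}"
  have N: "finite_complex N"
    unfolding finite_complex_def
  proof (intro conjI ballI allI impI)
    show "finite N" by (rule finite_subset[of _ "Pow {..<m}"]) (auto simp: N_def)
    show "{} \<in> N" by (simp add: N_def G_def)
    show "finite \<sigma>" if "\<sigma> \<in> N" for \<sigma> using that finite_subset by (auto simp: N_def)
    show "\<tau> \<in> N" if "\<sigma> \<in> N" "\<tau> \<subseteq> \<sigma>" for \<sigma> \<tau>
      using that Gsub[of "r ` \<sigma>" "r ` \<tau>"] by (auto simp: N_def)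
  qed
  have injN: "inj_on r \<sigma>" if "\<sigma> \<in> N" for \<sigma>
    using that inj_on_subset[OF r(1)] by (auto simp: N_def)
  have hullN: "convex hull (r ` \<sigma>) = affine_ext r ` closed_simplex \<sigma>" if "\<sigma> \<in> N" for \<sigma>
    using that injN finite_complexD[OF N] by (intro convex_hull_eq_affine_ext)
  have hullT: "convex hull (r ` \<sigma>) \<in> T" if "\<sigma> \<in> N" "\<sigma> \<noteq> {}" for \<sigma>
    using that by (auto simp: N_def G_def)
  have inj: "inj_on (affine_ext r) (realization N)"
  proof (rule inj_onI)
    \<comment> \<open>A point with support \<open>\<sigma>\<close> is mapped into the relative interior of the simplex of \<open>\<sigma>\<close>, so that a
      face of another simplex contains it only together with the whole simplex.\<close>
    have sub: "convex hull (r ` supp y) \<subseteq> convex hull (r ` supp y')"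
      if y: "y \<in> realization N" "y' \<in> realization N" and eq: "affine_ext r y = affine_ext r y'" for y y'
    proof -
      note s = supp_realization[OF N y(1)] supp_realization[OF N y(2)]
      have ind: "\<not> affine_dependent (r ` supp y)" using s by (auto simp: N_def G_def)
      have "affine_ext r y \<in> rel_interior (convex hull (r ` supp y))"
        unfolding rel_interior_convex_hull_explicit[OF ind]
      proof (intro CollectI exI conjI ballI)
        define u where "u x = y (inv_into (supp y) r x)" for x
        have u: "u (r v) = y v" if "v \<in> supp y" for v
          using that injN[OF s(1)] by (simp add: u_def)
        show "0 < u x" if x: "x \<in> r ` supp y" for x
        proof -
          obtain v where "v \<in> supp y" "x = r v" using x by auto
          moreover have "0 \<le> y v" using s by (auto simp: closed_simplex_def)
          ultimately show ?thesis using u by (simp add: supp_def)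
        qed
        show "sum u (r ` supp y) = 1"
          using s(4) by (simp add: sum.reindex[OF injN[OF s(1)]] u closed_simplex_def)
        show "(\<Sum>x\<in>r ` supp y. u x *\<^sub>R x) = affine_ext r y"
          by (simp add: sum.reindex[OF injN[OF s(1)]] u affine_ext_def)
      qed
      moreover have "affine_ext r y \<in> convex hull (r ` supp y')"
        using hullN s eq by auto
      moreover have "convex hull (r ` supp y) \<inter> convex hull (r ` supp y') face_of convex hull (r ` supp y)"
        using assms hullT s by (auto simp: simplicial_complex_def)
      ultimately show ?thesis
        using subset_of_face_of[of "convex hull (r ` supp y) \<inter> convex hull (r ` supp y')"
            "convex hull (r ` supp y)" "convex hull (r ` supp y)"] rel_interior_subset
        by (auto simp: disjnt_def)
    qed
    fix y y' assume y: "y \<in> realization N" "y' \<in> realization N" and eq: "affine_ext r y = affine_ext r y'"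
    note s = supp_realization[OF N y(1)] supp_realization[OF N y(2)]
    \<comment> \<open>Equal hulls have equal extreme points, hence the two supports agree; what
      remains is uniqueness of coordinates within one simplex.\<close>
    have "convex hull (r ` supp y) = convex hull (r ` supp y')"
      using sub[OF y eq] sub[OF y(2,1)] eq by auto
    moreover have ind: "\<not> affine_dependent (r ` supp y)" "\<not> affine_dependent (r ` supp y')"
      using s by (auto simp: N_def G_def)
    ultimately have "r ` supp y = r ` supp y'"
      using extreme_points_convex_hull by metis
    then have S: "supp y' = supp y"
      using inj_on_image_eq_iff[OF r(1)] s by (auto simp: N_def)
    have fin: "finite (supp y)" using s finite_complexD[OF N] by blast
    \<comment> \<open>The difference of the two coordinate vectors: its coefficients sum to 0 and so
      does the weighted sum of the vertices, which affine independence allows only for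
      \<open>u = 0\<close>.\<close>
    define u where "u x = y (inv_into (supp y) r x) - y' (inv_into (supp y) r x)" for x
    have u: "u (r v) = y v - y' v" if "v \<in> supp y" for v
      using that injN[OF s(1)] by (simp add: u_def)
    have "sum u (r ` supp y) = 0"
      using s(4,8) by (simp add: sum.reindex[OF injN[OF s(1)]] u closed_simplex_def sum_subtractf S)
    moreover have "(\<Sum>x\<in>r ` supp y. u x *\<^sub>R x) = 0"
      using eq by (simp add: sum.reindex[OF injN[OF s(1)]] u affine_ext_def sum_subtractf
          scaleR_diff_left S)
    ultimately have "\<forall>x\<in>r ` supp y. u x = 0"
      using ind fin by (auto simp: affine_dependent_explicit_finite)
    then have "\<forall>v\<in>supp y. y v = y' v" using u by auto
    then show "y = y'" using S by (fastforce simp: supp_def)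
  qed
  have "affine_ext r ` realization N = \<Union>T"
  proof (intro equalityI subsetI)
    fix z assume "z \<in> affine_ext r ` realization N"
    then obtain y where y: "y \<in> realization N" "z = affine_ext r y" by auto
    note s = supp_realization[OF N y(1)]
    have "z \<in> convex hull (r ` supp y)" using s(4) y(2) hullN[OF s(1)] by simp
    then show "z \<in> \<Union>T" using hullT[OF s(1,3)] by blast
  next
    fix z assume "z \<in> \<Union>T"
    then obtain S where S: "S \<in> T" "z \<in> S" by auto
    then obtain C where C: "\<not> affine_dependent C" "S = convex hull C"
      using assms unfolding simplicial_complex_def simplex_def by metis
    then have G: "C \<in> G" using S by (auto simp: G_def)
    define \<sigma> where "\<sigma> = {v\<in>{..<m}. r v \<in> C}"
    have "C \<subseteq> r ` {..<m}" using G r by auto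
    then have "r ` \<sigma> = C" by (auto simp: \<sigma>_def)
    moreover from this G have "\<sigma> \<in> N" by (auto simp: N_def \<sigma>_def)
    ultimately show "z \<in> affine_ext r ` realization N"
      using hullN[of \<sigma>] S C realization_eq[OF N] by auto
  qed
  with inj N hullT show ?thesis by (intro that[of N r]) (auto simp: bij_betw_def)
qed

section \<open>Subdivisions\<close>

text \<open>The sum over all vertices of \<open>K'\<close> in the definition agrees on
  \<open>realization K'\<close> with the sum over the support.\<close>

lemma is_subdivision_coord_ext:
  "is_subdivision K' K \<longleftrightarrow> finite_complex K' \<and>
     (\<exists>p. (\<forall>v\<in>\<Union>K'. p v \<in> realization K) \<and> (\<forall>\<sigma>\<in>K'. \<exists>\<tau>\<in>K. \<forall>v\<in>\<sigma>. supp (p v) \<subseteq> \<tau>) \<and>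
        bij_betw (coord_ext p) (realization K') (realization K))"
proof -
  have "bij_betw (\<lambda>y w. \<Sum>v\<in>\<Union>K'. y v * p v w) (realization K') (realization K) \<longleftrightarrow>
        bij_betw (coord_ext p) (realization K') (realization K)" if "finite_complex K'" for p
    using that supp_realization[OF that] finite_complexD[OF that]
    by (intro bij_betw_cong ext) (metis coord_ext_superset)
  then show ?thesis unfolding is_subdivision_def supp_def by auto
qed

lemma is_subdivisionI:
  assumes "finite_complex K'" "\<And>v. v \<in> \<Union>K' \<Longrightarrow> p v \<in> realization K"
    "\<And>\<sigma>. \<sigma> \<in> K' \<Longrightarrow> \<exists>\<tau>\<in>K. \<forall>v\<in>\<sigma>. supp (p v) \<subseteq> \<tau>"
    "bij_betw (coord_ext p) (realization K') (realization K)"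
  shows "is_subdivision K' K"
  unfolding is_subdivision_coord_ext using assms by (intro conjI exI[of _ p] ballI)

lemma is_subdivisionE:
  assumes "is_subdivision K' K"
  obtains p where "finite_complex K'" "\<And>v. v \<in> \<Union>K' \<Longrightarrow> p v \<in> realization K"
    "\<And>\<sigma>. \<sigma> \<in> K' \<Longrightarrow> \<exists>\<tau>\<in>K. \<forall>v\<in>\<sigma>. supp (p v) \<subseteq> \<tau>"
    "bij_betw (coord_ext p) (realization K') (realization K)"
proof -
  obtain p where "finite_complex K'" "\<forall>v\<in>\<Union>K'. p v \<in> realization K"
      "\<forall>\<sigma>\<in>K'. \<exists>\<tau>\<in>K. \<forall>v\<in>\<sigma>. supp (p v) \<subseteq> \<tau>"
      "bij_betw (coord_ext p) (realization K') (realization K)"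
    using assms unfolding is_subdivision_coord_ext by (elim conjE exE)
  then show ?thesis by (intro that[of p]) blast+
qed

lemma coord_ext_closed_simplex:
  assumes "finite \<sigma>" "finite \<tau>" "y \<in> closed_simplex \<sigma>" "\<And>v. v \<in> \<sigma> \<Longrightarrow> p v \<in> closed_simplex \<tau>"
  shows "coord_ext p y \<in> closed_simplex \<tau>"
proof -
  have y: "\<And>v. 0 \<le> y v" "supp y \<subseteq> \<sigma>" "sum y \<sigma> = 1" using assms(3) by (auto simp: closed_simplex_def)
  have p: "0 \<le> p v w" "w \<notin> \<tau> \<Longrightarrow> p v w = 0" "sum (p v) \<tau> = 1" if "v \<in> \<sigma>" for v w
    using assms(4)[OF that] by (auto simp: closed_simplex_def supp_def)
  have e: "coord_ext p y w = (\<Sum>v\<in>\<sigma>. y v * p v w)" for w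
    using coord_ext_superset assms(1) y(2) by blast
  have "(\<Sum>w\<in>\<tau>. coord_ext p y w) = (\<Sum>v\<in>\<sigma>. y v * sum (p v) \<tau>)"
    unfolding e sum_distrib_left by (rule sum.swap)
  also have "\<dots> = 1" using p y by simp
  finally have "(\<Sum>w\<in>\<tau>. coord_ext p y w) = 1" .
  moreover have "0 \<le> coord_ext p y w" for w unfolding e by (intro sum_nonneg mult_nonneg_nonneg p y)
  moreover have "coord_ext p y w = 0" if "w \<notin> \<tau>" for w unfolding e using p that by simp
  ultimately show ?thesis by (auto simp: closed_simplex_def supp_def)
qed

text \<open>The composition law for simplexwise affine maps, by exchanging two finite sums. It is
  applied both with simplices and with whole vertex sets as \<open>\<sigma>\<close> and
  \<open>\<tau>\<close>.\<close>

lemma affine_ext_coord_ext: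
  assumes "finite \<sigma>" "finite \<tau>" "supp y \<subseteq> \<sigma>" "\<And>v. v \<in> \<sigma> \<Longrightarrow> supp (p v) \<subseteq> \<tau>"
  shows "affine_ext q (coord_ext p y) = affine_ext (\<lambda>v. affine_ext q (p v)) y"
proof -
  have e: "coord_ext p y w = (\<Sum>v\<in>\<sigma>. y v * p v w)" for w
    using coord_ext_superset assms by blast
  have "supp (coord_ext p y) \<subseteq> \<tau>"
  proof
    fix w assume "w \<in> supp (coord_ext p y)"
    then obtain v where "v \<in> \<sigma>" "p v w \<noteq> 0"
      unfolding supp_def e by (metis (mono_tags, lifting) mem_Collect_eq mult_eq_0_iff sum.neutral)
    then show "w \<in> \<tau>" using assms by (auto simp: supp_def)
  qed
  then have "affine_ext q (coord_ext p y) = (\<Sum>w\<in>\<tau>. (\<Sum>v\<in>\<sigma>. y v * p v w) *\<^sub>R q w)"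
    using affine_ext_superset[OF assms(2), of "coord_ext p y" q] by (simp add: e)
  also have "\<dots> = (\<Sum>v\<in>\<sigma>. \<Sum>w\<in>\<tau>. (y v * p v w) *\<^sub>R q w)"
    unfolding scaleR_left.sum by (rule sum.swap)
  also have "\<dots> = (\<Sum>v\<in>\<sigma>. y v *\<^sub>R affine_ext q (p v))"
    using affine_ext_superset[OF assms(2) assms(4), of _ q] by (simp add: scaleR_right.sum)
  also have "\<dots> = affine_ext (\<lambda>v. affine_ext q (p v)) y"
    using affine_ext_superset[OF assms(1,3), of "\<lambda>v. affine_ext q (p v)"] by simp
  finally show ?thesis .
qed

lemma coord_ext_eq_affine_ext: "coord_ext p y w = affine_ext (\<lambda>v. p v w) y"
  by (simp add: coord_ext_def affine_ext_def)

lemma is_subdivision_trans: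
  assumes "is_subdivision N M" "is_subdivision M K"
  shows "is_subdivision N K"
proof -
  obtain p where N: "finite_complex N" and p: "\<And>v. v \<in> \<Union>N \<Longrightarrow> p v \<in> realization M"
      "\<And>\<sigma>. \<sigma> \<in> N \<Longrightarrow> \<exists>\<tau>\<in>M. \<forall>v\<in>\<sigma>. supp (p v) \<subseteq> \<tau>"
      "bij_betw (coord_ext p) (realization N) (realization M)"
    by (rule is_subdivisionE[OF assms(1)], rule that)
  obtain q where M: "finite_complex M" and q: "\<And>v. v \<in> \<Union>M \<Longrightarrow> q v \<in> realization K"
      "\<And>\<sigma>. \<sigma> \<in> M \<Longrightarrow> \<exists>\<tau>\<in>K. \<forall>v\<in>\<sigma>. supp (q v) \<subseteq> \<tau>"
      "bij_betw (coord_ext q) (realization M) (realization K)"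
    by (rule is_subdivisionE[OF assms(2)], rule that)
  \<comment> \<open>A vertex of \<open>N\<close> goes to the image in \<open>realization K\<close>
    of its position in \<open>realization M\<close>.\<close>
  let ?r = "\<lambda>v. coord_ext q (p v)"
  have "?r v \<in> realization K" if "v \<in> \<Union>N" for v
    using p(1)[OF that] q(3) bij_betwE by blast
  moreover have "\<exists>\<tau>\<in>K. \<forall>v\<in>\<sigma>. supp (?r v) \<subseteq> \<tau>" if \<sigma>: "\<sigma> \<in> N" for \<sigma>
  proof -
    obtain \<tau> where \<tau>: "\<tau> \<in> M" "\<forall>v\<in>\<sigma>. supp (p v) \<subseteq> \<tau>" using p(2)[OF \<sigma>] by blast
    obtain \<rho> where \<rho>: "\<rho> \<in> K" "\<forall>v\<in>\<tau>. supp (q v) \<subseteq> \<rho>" using q(2)[OF \<tau>(1)] by blast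
    have "supp (?r v) \<subseteq> \<rho>" if v: "v \<in> \<sigma>" for v
    proof
      fix w assume "w \<in> supp (?r v)"
      then have "coord_ext q (p v) w \<noteq> 0" by (simp add: supp_def)
      then obtain u where "u \<in> supp (p v)" "q u w \<noteq> 0"
        unfolding coord_ext_def by (metis (no_types, lifting) mult_zero_right sum.neutral)
      then show "w \<in> \<rho>" using \<tau> \<rho> v by (auto simp: supp_def)
    qed
    with \<rho> show ?thesis by blast
  qed
  moreover have "bij_betw (coord_ext ?r) (realization N) (realization K)"
  proof -
    have "coord_ext q (coord_ext p y) = coord_ext ?r y" if y: "y \<in> realization N" for y
    proof
      fix w
      show "coord_ext q (coord_ext p y) w = coord_ext ?r y w"
        \<comment> \<open>For fixed \<open>w\<close> this is the composition law for the real-valued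
          vertex map that sends \<open>u\<close> to \<open>q u w\<close>.\<close>
        unfolding coord_ext_eq_affine_ext[of q] coord_ext_eq_affine_ext[of ?r]
        using supp_realization(2)[OF N y] supp_realization(2)[OF M] p(1)
          finite_complexD(1)[OF N] finite_complexD(1)[OF M]
        by (intro affine_ext_coord_ext[of "\<Union>N" "\<Union>M"]) auto
    qed
    then show ?thesis
      using bij_betw_trans[OF p(3) q(3)]
        bij_betw_cong[of "realization N" "coord_ext q \<circ> coord_ext p" "coord_ext ?r"] by simp
  qed
  ultimately show ?thesis by (rule is_subdivisionI[OF N])
qed

section \<open>Isomorphisms as subdivisions\<close>

lemma complex_iso_sym:
  assumes "complex_iso K L"
  shows "complex_iso L K"
proof -
  obtain g where g: "bij_betw g (\<Union>K) (\<Union>L)" "(\<lambda>\<sigma>. g ` \<sigma>) ` K = L"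
    using assms by (auto simp: complex_iso_def)
  let ?h = "inv_into (\<Union>K) g"
  have "?h ` g ` \<sigma> = \<sigma>" if "\<sigma> \<in> K" for \<sigma>
    using that g(1) by (intro inv_into_image_cancel) (auto simp: bij_betw_def)
  then have "(\<lambda>\<sigma>. ?h ` \<sigma>) ` L = K" unfolding g(2)[symmetric] by (auto simp: image_image)
  with bij_betw_inv_into[OF g(1)] show ?thesis unfolding complex_iso_def by blast
qed

text \<open>Placing each \<open>v\<close> at the vertex \<open>g v\<close> merely renames
  coordinates. With this, an isomorphism in a chain of subdivisions is absorbed by
  \<open>is_subdivision_trans\<close>.\<close>

lemma complex_iso_imp_is_subdivision:
  assumes "complex_iso K L" "finite_complex K"
  shows "is_subdivision K L"
proof -
  obtain g where g: "bij_betw g (\<Union>K) (\<Union>L)" "(\<lambda>\<sigma>. g ` \<sigma>) ` K = L"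
    using assms by (auto simp: complex_iso_def)
  have ginj: "inj_on g (\<Union>K)" using g by (auto simp: bij_betw_def)
  have L: "finite_complex L"
    unfolding finite_complex_def g(2)[symmetric]
    using assms(2) by (fastforce simp: finite_complex_def subset_image_iff)
  define p where "p v = (\<lambda>w. if w = g v then 1 else (0::real))" for v
  have pL: "p v \<in> closed_simplex (g ` \<sigma>)" if "v \<in> \<sigma>" "\<sigma> \<in> K" for v \<sigma>
    unfolding p_def using that finite_complexD[OF assms(2)] by (intro closed_simplex_unit) auto
  have 1: "p v \<in> realization L" if "v \<in> \<Union>K" for v
    using that pL g(2) realization_eq[OF L] by blast
  have 2: "\<exists>\<tau>\<in>L. \<forall>v\<in>\<sigma>. supp (p v) \<subseteq> \<tau>" if "\<sigma> \<in> K" for \<sigma>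
    using that g(2) pL by (intro bexI[of _ "g ` \<sigma>"]) (auto simp: closed_simplex_def)
  have ev: "coord_ext p y (g v) = y v" if "y \<in> realization K" "v \<in> \<Union>K" for y v
  proof -
    have "coord_ext p y (g v) = (\<Sum>u\<in>\<Union>K. y u * p u (g v))"
      using that supp_realization[OF assms(2)] finite_complexD(1)[OF assms(2)]
      by (intro coord_ext_superset) auto
    also have "\<dots> = (\<Sum>u\<in>\<Union>K. if u = v then y u else 0)"
      using that inj_on_eq_iff[OF ginj] by (intro sum.cong) (auto simp: p_def)
    also have "\<dots> = y v" using that finite_complexD(1)[OF assms(2)] by simp
    finally show ?thesis .
  qed
  have mem: "coord_ext p y \<in> realization L" if "y \<in> realization K" for y
  proof -
    note s = supp_realization[OF assms(2) that]
    have "coord_ext p y \<in> closed_simplex (g ` supp y)"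
      using s pL finite_complexD(3)[OF assms(2)] by (intro coord_ext_closed_simplex[of "supp y"]) auto
    then show ?thesis using s g(2) realization_eq[OF L] by blast
  qed
  have "bij_betw (coord_ext p) (realization K) (realization L)"
    unfolding bij_betw_def
  proof (intro conjI inj_onI equalityI subsetI)
    fix y y' assume y: "y \<in> realization K" "y' \<in> realization K" "coord_ext p y = coord_ext p y'"
    show "y = y'"
    proof
      fix v
      show "y v = y' v"
      proof (cases "v \<in> \<Union>K")
        case True
        then show ?thesis using ev y by metis
      next
        case False
        then have "v \<notin> supp y" "v \<notin> supp y'"
          using supp_realization(2)[OF assms(2)] y by blast+
        then show ?thesis by (simp add: supp_def)
      qed
    qed
  next
    fix x assume "x \<in> coord_ext p ` realization K" then show "x \<in> realization L" using mem by auto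
  next
    fix x assume x: "x \<in> realization L"
    note s = supp_realization[OF L x]
    obtain \<sigma> where \<sigma>: "\<sigma> \<in> K" "supp x = g ` \<sigma>" using s g(2) by auto
    define y where "y = (\<lambda>v. if v \<in> \<sigma> then x (g v) else 0)"
    have "inj_on g \<sigma>" using ginj \<sigma> inj_on_subset by blast
    then have "y \<in> closed_simplex \<sigma>"
      using s(4) \<sigma>(2) by (auto simp: closed_simplex_def y_def supp_def sum.reindex)
    then have y: "y \<in> realization K" using \<sigma> realization_eq[OF assms(2)] by auto
    have "coord_ext p y w = x w" for w
    proof (cases "w \<in> \<Union>L")
      case True
      then obtain v where v: "v \<in> \<Union>K" "w = g v" using g(1) unfolding bij_betw_def by blast
      have "x (g v) = 0" if "v \<notin> \<sigma>"
      proof (rule ccontr)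
        assume "x (g v) \<noteq> 0"
        then have "g v \<in> g ` \<sigma>" using \<sigma> by (auto simp: supp_def)
        then show False using that v \<sigma> inj_on_image_mem_iff[OF ginj v(1)] by auto
      qed
      then show ?thesis using v ev[OF y v(1)] by (auto simp: y_def)
    next
      case False
      then have "w \<notin> supp x" "w \<notin> supp (coord_ext p y)"
        using supp_realization(2)[OF L x] supp_realization(2)[OF L mem[OF y]] by blast+
      then show ?thesis by (simp add: supp_def)
    qed
    then have "x = coord_ext p y" by auto
    then show "x \<in> coord_ext p ` realization K" using y by (rule image_eqI)
  qed
  with assms(2) 1 2 show ?thesis by (rule is_subdivisionI)
qed

section \<open>Subdivisions within one Euclidean space\<close>

text \<open>The vertex positions in \<open>realization L\<close> are found by pulling the points
  \<open>r v\<close> back along the embedding of \<open>L\<close>. Containment of each simplex of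
  \<open>N\<close> in a single simplex of \<open>L\<close> makes this pullback affine on
  simplices.\<close>

lemma is_subdivisionI_geometric:
  fixes q r :: "nat \<Rightarrow> 'a::euclidean_space"
  assumes N: "finite_complex N" and L: "geometric_complex L q"
    and bijL: "bij_betw (affine_ext q) (realization L) X"
    and bijN: "bij_betw (affine_ext r) (realization N) X"
    and sub: "\<And>\<sigma>. \<sigma> \<in> N \<Longrightarrow> \<exists>\<tau>\<in>L. r ` \<sigma> \<subseteq> convex hull (q ` \<tau>)"
  shows "is_subdivision N L"
proof -
  interpret L: geometric_complex L q by fact
  define p where "p v = inv_into (realization L) (affine_ext q) (r v)" for v
  have p: "p v \<in> closed_simplex \<tau>" "affine_ext q (p v) = r v"
    if v: "r v \<in> convex hull (q ` \<tau>)" "\<tau> \<in> L" for v \<tau>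
  proof -
    obtain y where y: "y \<in> closed_simplex \<tau>" "r v = affine_ext q y"
      using v L.hull_eq by auto
    then have "p v = y" using L.inj L.simplex_subset[OF v(2)] by (auto simp: p_def)
    with y show "p v \<in> closed_simplex \<tau>" "affine_ext q (p v) = r v" by auto
  qed
  have sub': "\<exists>\<tau>\<in>L. \<forall>v\<in>\<sigma>. p v \<in> closed_simplex \<tau> \<and> affine_ext q (p v) = r v" if \<sigma>: "\<sigma> \<in> N" for \<sigma>
  proof -
    obtain \<tau> where "\<tau> \<in> L" "r ` \<sigma> \<subseteq> convex hull (q ` \<tau>)" using sub[OF \<sigma>] by blast
    with p show ?thesis by (intro bexI[of _ \<tau>]) auto
  qed
  have 1: "p v \<in> realization L" if v: "v \<in> \<Union>N" for v
  proof -
    obtain \<sigma> where \<sigma>: "\<sigma> \<in> N" "v \<in> \<sigma>" using v by blast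
    then obtain \<tau> where "\<tau> \<in> L" "p v \<in> closed_simplex \<tau>" using sub' by blast
    then show ?thesis using L.simplex_subset by blast
  qed
  have 2: "\<exists>\<tau>\<in>L. \<forall>v\<in>\<sigma>. supp (p v) \<subseteq> \<tau>" if "\<sigma> \<in> N" for \<sigma>
    using sub'[OF that] by (auto simp: closed_simplex_def)
  have mem: "coord_ext p y \<in> realization L \<and> affine_ext q (coord_ext p y) = affine_ext r y"
    if "y \<in> realization N" for y
  proof -
    note s = supp_realization[OF N that]
    obtain \<tau> where \<tau>: "\<tau> \<in> L" "\<forall>v\<in>supp y. p v \<in> closed_simplex \<tau> \<and> affine_ext q (p v) = r v"
      using sub'[OF s(1)] by blast
    have fin: "finite (supp y)" "finite \<tau>"
      by (rule finite_complexD(3)[OF N s(1)], rule finite_complexD(3)[OF L.complex \<tau>(1)])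
    have "coord_ext p y \<in> closed_simplex \<tau>"
      using s(4) \<tau>(2) fin by (intro coord_ext_closed_simplex[of "supp y"]) blast+
    moreover have "affine_ext q (coord_ext p y) = affine_ext (\<lambda>v. affine_ext q (p v)) y"
      using \<tau> fin by (intro affine_ext_coord_ext[of "supp y" \<tau>]) (auto simp: closed_simplex_def)
    moreover have "affine_ext (\<lambda>v. affine_ext q (p v)) y = affine_ext r y"
      using \<tau> by (simp add: affine_ext_def)
    ultimately show ?thesis using L.simplex_subset[OF \<tau>(1)] by auto
  qed
  \<comment> \<open>The composite with the bijection \<open>affine_ext q\<close> is
    \<open>affine_ext r\<close>, so that bijection can be cancelled.\<close>
  have "bij_betw (affine_ext q \<circ> coord_ext p) (realization N) X \<longleftrightarrow> bij_betw (affine_ext r) (realization N) X"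
    by (rule bij_betw_cong) (simp add: mem)
  moreover have "coord_ext p ` realization N \<subseteq> realization L" using mem by auto
  ultimately have "bij_betw (coord_ext p) (realization N) (realization L)"
    using bijN bij_betw_comp_iff2[OF bijL] by metis
  with N 1 2 show ?thesis by (rule is_subdivisionI)
qed

text \<open>Composing the bijection from a subdivision to \<open>K\<close> with the embedding of
  \<open>K\<close> embeds the subdivision with the same image \<open>?X\<close>. Both subdivisions
  thus triangulate one subset of Euclidean space and can be superposed.\<close>

lemma common_subdivision:
  fixes q :: "nat \<Rightarrow> 'a::euclidean_space"
  assumes K: "geometric_complex K q" and "is_subdivision L1 K" "is_subdivision L2 K"
  obtains N where "is_subdivision N L1" "is_subdivision N L2"
proof -
  interpret K: geometric_complex K q by fact
  let ?X = "affine_ext q ` realization K"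
  have *: "\<exists>r. geometric_complex L r \<and> bij_betw (affine_ext r) (realization L) ?X"
    if L: "is_subdivision L K" for L
  proof -
    obtain p where N: "finite_complex L" and p: "\<And>v. v \<in> \<Union>L \<Longrightarrow> p v \<in> realization K"
        "\<And>\<sigma>. \<sigma> \<in> L \<Longrightarrow> \<exists>\<tau>\<in>K. \<forall>v\<in>\<sigma>. supp (p v) \<subseteq> \<tau>"
        "bij_betw (coord_ext p) (realization L) (realization K)"
      by (rule is_subdivisionE[OF L], rule that)
    let ?r = "\<lambda>v. affine_ext q (p v)"
    have eq: "affine_ext q (coord_ext p y) = affine_ext ?r y" if y: "y \<in> realization L" for y
      using supp_realization(2)[OF N y] supp_realization(2)[OF K.complex] p(1)
        finite_complexD(1)[OF N] finite_complexD(1)[OF K.complex]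
      by (intro affine_ext_coord_ext[of "\<Union>L" "\<Union>K"]) auto
    have "bij_betw (affine_ext q \<circ> coord_ext p) (realization L) ?X"
      using bij_betw_trans[OF p(3) inj_on_imp_bij_betw[OF K.inj]] .
    moreover have "bij_betw (affine_ext q \<circ> coord_ext p) (realization L) ?X \<longleftrightarrow>
        bij_betw (affine_ext ?r) (realization L) ?X"
      by (rule bij_betw_cong) (simp add: eq)
    ultimately have "bij_betw (affine_ext ?r) (realization L) ?X" by simp
    then show ?thesis using N by (auto simp: geometric_complex_def bij_betw_def)
  qed
  obtain r1 where r1: "geometric_complex L1 r1" "bij_betw (affine_ext r1) (realization L1) ?X"
    using *[OF assms(2)] by blast
  obtain r2 where r2: "geometric_complex L2 r2" "bij_betw (affine_ext r2) (realization L2) ?X"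
    using *[OF assms(3)] by blast
  obtain T where T: "simplicial_complex T" "\<Union>T = ?X"
    "\<And>S. S \<in> T \<Longrightarrow> \<exists>\<tau>\<in>L1. S \<subseteq> convex hull (r1 ` \<tau>)"
    "\<And>S. S \<in> T \<Longrightarrow> \<exists>\<tau>\<in>L2. S \<subseteq> convex hull (r2 ` \<tau>)"
    using common_refinement[OF r1(1) r2(1)] r1(2) r2(2) unfolding bij_betw_def by metis
  obtain N and r :: "nat \<Rightarrow> 'a" where N: "finite_complex N"
    "bij_betw (affine_ext r) (realization N) ?X"
    "\<And>\<sigma>. \<sigma> \<in> N \<Longrightarrow> \<sigma> \<noteq> {} \<Longrightarrow> convex hull (r ` \<sigma>) \<in> T"
    using simplicial_complex_abstract[OF T(1)] unfolding T(2) by metis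
  have "is_subdivision N L" if "geometric_complex L s" "bij_betw (affine_ext s) (realization L) ?X"
      "\<And>S. S \<in> T \<Longrightarrow> \<exists>\<tau>\<in>L. S \<subseteq> convex hull (s ` \<tau>)" for L s
  proof (rule is_subdivisionI_geometric[OF N(1) that(1,2) N(2)])
    fix \<sigma> assume \<sigma>: "\<sigma> \<in> N"
    show "\<exists>\<tau>\<in>L. r ` \<sigma> \<subseteq> convex hull (s ` \<tau>)"
    \<comment> \<open>The empty simplex is not covered by \<open>N(3)\<close>; it lies in the empty
      simplex of \<open>L\<close>.\<close>
    proof (cases "\<sigma> = {}")
      case True
      then show ?thesis using that(1) finite_complexD(2) by (auto simp: geometric_complex_def)
    next
      case False
      then show ?thesis using that(3)[OF N(3)[OF \<sigma>]] hull_subset[of "r ` \<sigma>" convex] by blast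
    qed
  qed
  then show ?thesis using r1 r2 T by (intro that[of N]) blast+
qed

section \<open>Embedding by the moment curve\<close>

text \<open>Vandermonde independence without determinants: by linearity \<open>c\<close> annihilates
  every polynomial of degree at most \<open>D\<close>, in particular \<open>P\<close>, which
  vanishes on all of \<open>S\<close> except \<open>u\<close>. Including the power 0 yields affine,
  not just linear, independence.\<close>

lemma power_sums_zero:
  fixes c :: "nat \<Rightarrow> real"
  assumes "finite S" "card S \<le> Suc D" "\<And>k. k \<le> D \<Longrightarrow> (\<Sum>v\<in>S. c v * real v ^ k) = 0" "u \<in> S"
  shows "c u = 0"
proof -
  define P where "P = (\<Prod>w\<in>S - {u}. [:- real w, 1:])"
  have "degree P \<le> card (S - {u})"
    unfolding P_def by (rule order_trans[OF degree_prod_sum_le]) (auto simp: assms)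
  then have deg: "degree P \<le> D" using assms by simp
  have "(\<Sum>v\<in>S. c v * poly P (real v)) = (\<Sum>v\<in>S. \<Sum>k\<le>degree P. coeff P k * (c v * real v ^ k))"
    by (simp add: poly_altdef sum_distrib_left mult.left_commute)
  also have "\<dots> = (\<Sum>k\<le>degree P. coeff P k * (\<Sum>v\<in>S. c v * real v ^ k))"
    by (subst sum.swap) (simp add: sum_distrib_left)
  also have "\<dots> = 0" using assms(3) deg by simp
  finally have "(\<Sum>v\<in>S. c v * poly P (real v)) = 0" .
  moreover have "(\<Sum>v\<in>S. c v * poly P (real v)) = (\<Sum>v\<in>{u}. c v * poly P (real v))"
    using assms by (intro sum.mono_neutral_right) (auto simp: P_def poly_prod)
  moreover have "poly P (real u) \<noteq> 0" using assms by (auto simp: P_def poly_prod)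
  ultimately show ?thesis by simp
qed

text \<open>Two points with the same image involve at most \<open>2 * d\<close> vertices, whose
  points on the curve are affinely independent, so their coordinates agree. For simplices of
  dimension \<open>k = d - 1\<close> this is the classical bound \<open>2 * k + 1\<close>.\<close>

lemma moment_curve_geometric_complex:
  assumes K: "finite_complex K" and card: "\<And>\<sigma>. \<sigma> \<in> K \<Longrightarrow> card \<sigma> \<le> d"
    and DIM: "2 * d \<le> Suc DIM('a::euclidean_space)"
  obtains q :: "nat \<Rightarrow> 'a::euclidean_space" where "geometric_complex K q"
proof -
  let ?D = "DIM('a)"
  obtain e where e: "bij_betw e {1..?D} (Basis :: 'a set)"
    using ex_bij_betw_nat_finite_1[OF finite_Basis] by (rule exE)
  \<comment> \<open>The curve starts with the first power; the equation for the power 0 comes from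
    barycentric coordinates having sum 1.\<close>
  define q where "q v = (\<Sum>k=1..?D. real v ^ k *\<^sub>R e k)" for v :: nat
  have inner: "q v \<bullet> e k = real v ^ k" if "k \<in> {1..?D}" for v k
  proof -
    have "e j \<bullet> e k = (if j = k then 1 else 0)" if j: "j \<in> {1..?D}" for j
    proof -
      have "e j \<in> Basis" "e k \<in> Basis" "e j = e k \<longleftrightarrow> j = k"
        using bij_betwE[OF e] inj_on_eq_iff[OF bij_betw_imp_inj_on[OF e]] j \<open>k \<in> {1..?D}\<close> by blast+
      then show ?thesis by (simp add: inner_Basis)
    qed
    then have "q v \<bullet> e k = (\<Sum>j=1..?D. if j = k then real v ^ j else 0)"
      unfolding q_def inner_sum_left by (intro sum.cong) auto
    also have "\<dots> = real v ^ k" using that by (subst sum.delta) auto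
    finally show ?thesis .
  qed
  have "inj_on (affine_ext q) (realization K)"
  proof (rule inj_onI)
    fix y y' assume y: "y \<in> realization K" "y' \<in> realization K" and eq: "affine_ext q y = affine_ext q y'"
    note s = supp_realization[OF K y(1)] supp_realization[OF K y(2)]
    define S where "S = supp y \<union> supp y'"
    have fin: "finite S" using s finite_complexD(3)[OF K] by (auto simp: S_def)
    have "card S \<le> Suc ?D"
      using card[OF s(1)] card[OF s(5)] DIM card_Un_le[of "supp y" "supp y'"] by (auto simp: S_def)
    moreover have "(\<Sum>v\<in>S. (y v - y' v) * real v ^ k) = 0" if k: "k \<le> ?D" for k
    proof (cases "k = 0")
      case True
      have "y \<in> closed_simplex S" "y' \<in> closed_simplex S"
        using s closed_simplex_mono[of _ S] fin by (auto simp: S_def)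
      then show ?thesis using True by (simp add: closed_simplex_def sum_subtractf)
    next
      case False
      then have k: "k \<in> {1..?D}" using k by auto
      have "(\<Sum>v\<in>S. z v * real v ^ k) = affine_ext q z \<bullet> e k" if "supp z \<subseteq> S" for z
        using affine_ext_superset[OF fin that, of q] by (simp add: inner_sum_left inner[OF k])
      from this[of y] this[of y'] show ?thesis
        by (simp add: left_diff_distrib sum_subtractf eq S_def)
    qed
    ultimately have "y v - y' v = 0" if "v \<in> S" for v
      using power_sums_zero[OF fin, of ?D "\<lambda>v. y v - y' v" v] that by blast
    moreover have "y v = 0 \<and> y' v = 0" if "v \<notin> S" for v using that by (auto simp: S_def supp_def)
    ultimately show "y = y'" by (metis eq_iff_diff_eq_0 ext)
  qed
  with K show ?thesis by (intro that[of q]) (simp add: geometric_complex_def)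
qed

section \<open>PL homeomorphism\<close>

lemma pl_homeomorphic_sym: "pl_homeomorphic K L \<Longrightarrow> pl_homeomorphic L K"
  using complex_iso_sym unfolding pl_homeomorphic_def by blast

lemma complex_iso_refl: "complex_iso K K"
  unfolding complex_iso_def by (intro exI[of _ id]) auto

text \<open>Through the isomorphisms \<open>K1\<close> subdivides \<open>A'\<close> and
  \<open>K2\<close> subdivides \<open>B'\<close>. A common subdivision \<open>N\<close> of
  \<open>K1\<close> and \<open>K2\<close> therefore subdivides \<open>A\<close> and
  \<open>B\<close>, and the identity of \<open>N\<close> is the required isomorphism. Only the
  middle complex has to be embedded.\<close>

lemma pl_homeomorphic_trans:
  fixes q :: "nat \<Rightarrow> 'a::euclidean_space"
  assumes "pl_homeomorphic A K" "pl_homeomorphic K B" and "geometric_complex K q"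
  shows "pl_homeomorphic A B"
proof -
  obtain A' K1 where 1: "is_subdivision A' A" "is_subdivision K1 K" "complex_iso A' K1"
    using assms(1) by (auto simp: pl_homeomorphic_def)
  obtain K2 B' where 2: "is_subdivision K2 K" "is_subdivision B' B" "complex_iso K2 B'"
    using assms(2) by (auto simp: pl_homeomorphic_def)
  obtain N where N: "is_subdivision N K1" "is_subdivision N K2"
    using common_subdivision[OF assms(3) 1(2) 2(1)] by blast
  have "is_subdivision K1 A'" "is_subdivision K2 B'"
    using 1 2 complex_iso_sym complex_iso_imp_is_subdivision by (auto simp: is_subdivision_def)
  then have "is_subdivision N A" "is_subdivision N B"
    using N 1 2 is_subdivision_trans by blast+
  then show ?thesis using complex_iso_refl unfolding pl_homeomorphic_def by blast
qed

lemma PL_geometric_complex: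
  assumes "K \<in> PL n" "n \<le> 4"
  obtains q :: "nat \<Rightarrow> real ^ 9" where "geometric_complex (simplices K) q"
\<comment> \<open>A simplex of an \<open>n\<close>-manifold with \<open>n \<le> 4\<close> has at
  most 5 vertices, and \<open>2 * 5 = Suc 9\<close>.\<close>
proof (rule moment_curve_geometric_complex[of "simplices K" 5])
  show "finite_complex (simplices K)" using assms by (auto simp: PL_def TM_def)
  show "card \<sigma> \<le> 5" if "\<sigma> \<in> simplices K" for \<sigma>
    using that assms by (cases "\<sigma> = {}") (force simp: PL_def)+
qed auto

lemma pl_type_subset:
  assumes "pl_homeomorphic (simplices K) (simplices K')" "K \<in> PL n" "n \<le> 4"
  shows "pl_type n K \<subseteq> pl_type n K'"
proof -
  obtain q :: "nat \<Rightarrow> real ^ 9" where "geometric_complex (simplices K) q"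
    using PL_geometric_complex[OF assms(2,3)] .
  then show ?thesis
    using pl_homeomorphic_trans assms(1) by (fastforce simp: pl_type_def)
qed

section \<open>Independence of the representative\<close>

lemma algebra_isomorphic_refl: "algebra_isomorphic A A"
  unfolding algebra_isomorphic_def
  by (rule bexI[of _ id]) (auto simp: ring_iso_def ring_hom_def)

theorem theorem6p5:
  fixes n :: nat and K K' :: oriented_complex
    and \<sigma> :: "oriented_complex \<Rightarrow> nat set \<Rightarrow> nat \<Rightarrow> nat"
    and p :: "'p::semifield coefficients"
  assumes "n \<in> {2, 4}"
    and "K \<in> PL n" and "K' \<in> PL n"
    and "pl_homeomorphic (simplices K) (simplices K')"
    and "involution_choice n (pl_type n K) \<sigma>"
    and "seed_family n (pl_type n K) \<sigma> p"
  shows "algebra_isomorphic (A_PL n \<sigma> p K) (A_PL n \<sigma> p K')"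
proof -
  \<comment> \<open>Each inclusion uses the embedding of its own middle complex, \<open>K\<close>
    for one and \<open>K'\<close> for the other.\<close>
  have "pl_type n K = pl_type n K'"
    using assms(1-4) pl_homeomorphic_sym by (intro equalityI pl_type_subset) auto
  then have "A_PL n \<sigma> p K = A_PL n \<sigma> p K'"
    by (simp add: A_PL_def pl_classes_def)
  then show ?thesis using algebra_isomorphic_refl by simp
qed

end
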